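(* Let $\mathrm{H}$ be a real Hilbert space. Let $(A,f) \in \mathcal{A}(\cdot,\mathrm{H}) \times \Gamma_0(\cdot,\mathrm{H})$ and let $x : \mathbb{R}_+ \to \mathrm{H}$ be a function. Consider the function $y : \mathbb{R}_+ \to \mathrm{H}$ defined by $$y(t) := \mathrm{prox}_{A(t,\cdot),f(t,\cdot)}(x(t))$$ for all $t \ge 0$. If the following assertions are satisfied: (i) $x$ is differentiable at $t=0$; (ii) $A \in \mathcal{A}_{\mathrm{unif}}(\cdot,\mathrm{H})$; (iii) $A$ is semi-differentiable at $y(0)$; (iv) $f$ is twice epi-differentiable at $y(0)$ for $v_0 := x(0) - A(0,y(0)) \in \partial f(0,y(0))$; (v) $d^2_e f(y(0)|v_0) \in \Gamma_0(\mathrm{H})$; then $y : \mathbb{R}_+ \to \mathrm{H}$ is differentiable at $t=0$ with $$y'(0) = \mathrm{prox}_{D_sA(y(0)),\, d^2_e f(y(0)|v_0)}(x'(0)).$$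
   Context: Let $\mathrm{H}$ be a real Hilbert space with scalar product $\langle\cdot,\cdot\rangle$ and norm $\|\cdot\|$; $\mathbb{R}_+=[0,+\infty)$. Differentiability at $t=0$ of functions defined on $\mathbb{R}_+$ is from the right. Set limits (always as $\tau\to0$, $\tau>0$). For a family $(S_\tau)_{\tau>0}$ of subsets of a Hilbert space: $\mathrm{w}\text{-}\limsup S_\tau$ is the set of $x$ for which there exist positive $t_n\to0$ and $x_n\rightharpoonup x$ (weakly) with $x_n\in S_{t_n}$ for all $n$; $\liminf S_\tau$ is the set of $x$ such that for every positive sequence $t_n\to0$ there exist $x_n\to x$ strongly and $N$ with $x_n\in S_{t_n}$ for all $n\ge N$. The family is M-convergent (Mosco) if $\mathrm{w}\text{-}\limsup S_\tau\subset\liminf S_\tau$, and then its limit is $\liminf S_\tau$. A family of functions $f_\tau:\mathrm{H}\to\mathbb{R}\cup\{\pm\infty\}$ is M-convergent if the epigraphs $\{(x,\lambda)\in\mathrm{H}\times\mathbb{R}: f_\tau(x)\le\lambda\}$ are M-convergent in $\mathrm{H}\times\mathbb{R}$; its limit is the function whose epigraph is the limit. $\Gamma_0(\mathrm{H})$ is the set of proper, lower semi-continuous, convex functions $\mathrm{H}\to\mathbb{R}\cup\{+\infty\}$, with subdifferential $\partial f(x)=\{y:\langle y,z-x\rangle\le f(z)-f(x)\ \forall z\in\mathrm{H}\}$. $\Gamma_0(\cdot,\mathrm{H})$ is the set of $f:\mathbb{R}_+\times\mathrm{H}\to\mathbb{R}\cup\{+\infty\}$ with $f(t,\cdot)\in\Gamma_0(\mathrm{H})$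 for all $t\ge0$; $\partial f(t,x):=\partial(f(t,\cdot))(x)$ and $f^{-1}(\cdot,\mathbb{R}):=\{x\in\mathrm{H}: f(t,x)\in\mathbb{R}\ \forall t\ge0\}$. $\mathcal{A}(\mathrm{H})$ is the set of maps $A:\mathrm{H}\to\mathrm{H}$ that are Lipschitz continuous and strongly monotone ($\exists\alpha>0$: $\langle A(x_2)-A(x_1),x_2-x_1\rangle\ge\alpha\|x_2-x_1\|^2$ for all $x_1,x_2$). $\mathcal{A}(\cdot,\mathrm{H})$ is the set of $A:\mathbb{R}_+\times\mathrm{H}\to\mathrm{H}$ with $A(t,\cdot)\in\mathcal{A}(\mathrm{H})$ for all $t\ge0$. $\mathcal{A}_{\mathrm{unif}}(\cdot,\mathrm{H})$ is the set of those for which the Lipschitz constant $M\ge0$ and the strong monotonicity constant $\alpha>0$ can be chosen independently of $t\ge0$. For $(A,f)\in\mathcal{A}(\mathrm{H})\times\Gamma_0(\mathrm{H})$, $\mathrm{prox}_{A,f}:=(A+\partial f)^{-1}$; it is a single-valued map $\mathrm{H}\to\mathrm{H}$, and $y=\mathrm{prox}_{A,f}(x)$ is the unique $y\in\mathrm{H}$ with $\langle A(y),z-y\rangle+f(z)-f(y)\ge\langle x,z-y\rangle$ for all $z\in\mathrm{H}$. Semi-differentiability: $A:\mathbb{R}_+\times\mathrm{H}\to\mathrm{H}$ is semi-differentiable at $x$ if for all $w\in\mathrm{H}$ the limit $D_sA(x)(w):=\lim_{\tau\to0^+,\,w'\to w}\frac{A(\tau,x+\tau w')-A(0,x)}{\tau}$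 exists in $\mathrm{H}$; $D_sA(x):\mathrm{H}\to\mathrm{H}$ is the semi-derivative. (If $A\in\mathcal{A}_{\mathrm{unif}}(\cdot,\mathrm{H})$, then $D_sA(x)\in\mathcal{A}(\mathrm{H})$.) Twice epi-differentiability: for $f\in\Gamma_0(\cdot,\mathrm{H})$, $x\in f^{-1}(\cdot,\mathbb{R})$, $v\in\partial f(0,x)$, put $\Delta^2_\tau f(x|v)(w):=\frac{f(\tau,x+\tau w)-f(\tau,x)-\tau\langle v,w\rangle}{\tau^2}$. $f$ is twice epi-differentiable at $x$ for $v$ if $(\Delta^2_\tau f(x|v))_{\tau>0}$ is M-convergent; the limit function is denoted $d^2_ef(x|v):\mathrm{H}\to\mathbb{R}\cup\{\pm\infty\}$. Saying that $f$ is twice epi-differentiable at $x$ for $v$ includes the requirement $x\in f^{-1}(\cdot,\mathbb{R})$. *)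

theory Defs
  imports "HOL-Analysis.Analysis"
begin

text \<open>All families are indexed by real parameters, but only the values at \<open>\<tau> > 0\<close>
  (for limits as \<open>\<tau> \<rightarrow> 0\<close>) or \<open>t \<ge> 0\<close> (for the time parameter) matter.
  Weak convergence is tested against the vectors of the space; on a Hilbert space these
  represent all continuous linear functionals.\<close>

definition weakly_tendsto :: "(nat \<Rightarrow> 'a::real_inner) \<Rightarrow> 'a \<Rightarrow> bool" where
  "weakly_tendsto X x \<longleftrightarrow> (\<forall>h. (\<lambda>n. X n \<bullet> h) \<longlonglongrightarrow> x \<bullet> h)"

definition w_limsup_set :: "(real \<Rightarrow> 'a::real_inner set) \<Rightarrow> 'a set" where
  "w_limsup_set S = {x. \<exists>t X. (\<forall>n. t n > 0) \<and> t \<longlonglongrightarrow> 0 \<and>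
      weakly_tendsto X x \<and> (\<forall>n::nat. X n \<in> S (t n))}"

definition liminf_set :: "(real \<Rightarrow> 'a::real_inner set) \<Rightarrow> 'a set" where
  "liminf_set S = {x. \<forall>t. (\<forall>n. t n > 0) \<and> t \<longlonglongrightarrow> 0 \<longrightarrow>
      (\<exists>X N. X \<longlonglongrightarrow> x \<and> (\<forall>n\<ge>N::nat. X n \<in> S (t n)))}"

definition M_convergent_set :: "(real \<Rightarrow> 'a::real_inner set) \<Rightarrow> bool" where
  "M_convergent_set S \<longleftrightarrow> w_limsup_set S \<subseteq> liminf_set S"

definition epi :: "('a \<Rightarrow> ereal) \<Rightarrow> ('a \<times> real) set" where
  "epi f = {(x, r). f x \<le> ereal r}"

definition M_convergent :: "(real \<Rightarrow> 'a::real_inner \<Rightarrow> ereal) \<Rightarrow> bool" where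
  "M_convergent F \<longleftrightarrow> M_convergent_set (\<lambda>\<tau>. epi (F \<tau>))"

text \<open>The set limit of an M-convergent family is its lower limit. The function below is well
  defined for every family, see \<open>epi_M_lim\<close>; it is only of interest for M-convergent ones.\<close>

definition M_lim :: "(real \<Rightarrow> 'a::real_inner \<Rightarrow> ereal) \<Rightarrow> 'a \<Rightarrow> ereal" where
  "M_lim F = (THE g. epi g = liminf_set (\<lambda>\<tau>. epi (F \<tau>)))"

lemma epi_inject: "epi f = epi g \<longleftrightarrow> f = g"
proof
  assume eq: "epi f = epi g"
  have "f x = g x" for x
  proof -
    have iff: "f x \<le> ereal r \<longleftrightarrow> g x \<le> ereal r" for r
      using eq by (auto simp: epi_def set_eq_iff)
    show ?thesis
    proof (rule antisym)
      show "f x \<le> g x"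
        by (rule ereal_le_real) (use iff in auto)
      show "g x \<le> f x"
        by (rule ereal_le_real) (use iff in auto)
    qed
  qed
  then show "f = g" by auto
qed auto

lemma liminf_set_iff:
  "x \<in> liminf_set S \<longleftrightarrow> (\<forall>e>0. \<forall>\<^sub>F \<tau> in at_right 0. \<exists>s\<in>S \<tau>. dist s x < e)"
proof
  assume x: "x \<in> liminf_set S"
  show "\<forall>e>0. \<forall>\<^sub>F \<tau> in at_right 0. \<exists>s\<in>S \<tau>. dist s x < e"
  proof (intro allI impI, rule ccontr)
    fix e :: real
    assume "e > 0" and neg: "\<not> (\<forall>\<^sub>F \<tau> in at_right 0. \<exists>s\<in>S \<tau>. dist s x < e)"
    have "\<exists>t>0. t < inverse (real (Suc n)) \<and> \<not> (\<exists>s\<in>S t. dist s x < e)" for n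
      using neg unfolding eventually_at_right_field
      by (metis inverse_positive_iff_positive of_nat_0_less_iff zero_less_Suc)
    then obtain t where t: "\<And>n. t n > 0" "\<And>n. t n < inverse (real (Suc n))"
        "\<And>n. \<not> (\<exists>s\<in>S (t n). dist s x < e)"
      by metis
    have "t \<longlonglongrightarrow> 0"
      by (rule tendsto_sandwich[OF _ _ tendsto_const LIMSEQ_inverse_real_of_nat])
         (use t in \<open>auto intro!: always_eventually less_imp_le\<close>)
    with t x obtain X N where X: "X \<longlonglongrightarrow> x" "\<And>n. n \<ge> N \<Longrightarrow> X n \<in> S (t n)"
      unfolding liminf_set_def by blast
    obtain M where "\<And>n. n \<ge> M \<Longrightarrow> dist (X n) x < e"
      using X(1) \<open>e > 0\<close> unfolding lim_sequentially by blast
    then show False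
      using X(2)[of "max M N"] t(3)[of "max M N"] by auto
  qed
next
  assume ev: "\<forall>e>0. \<forall>\<^sub>F \<tau> in at_right 0. \<exists>s\<in>S \<tau>. dist s x < e"
  show "x \<in> liminf_set S"
    unfolding liminf_set_def
  proof (intro CollectI allI impI, elim conjE)
    fix t :: "nat \<Rightarrow> real"
    assume t: "\<forall>n. t n > 0" "t \<longlonglongrightarrow> 0"
    have lim: "filterlim t (at_right 0) sequentially"
      unfolding filterlim_at using t by (metis (mono_tags, lifting) always_eventually greaterThan_iff less_irrefl)
    have ev': "\<forall>\<^sub>F n in sequentially. \<exists>s\<in>S (t n). dist s x < e" if "e > 0" for e
      using ev that lim unfolding filterlim_iff by blast
    have "\<exists>X. \<forall>n. S (t n) \<noteq> {} \<longrightarrow> X n \<in> S (t n) \<and> dist (X n) x < infdist x (S (t n)) + t n"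
    proof (intro choice allI)
      fix n
      show "\<exists>y. S (t n) \<noteq> {} \<longrightarrow> y \<in> S (t n) \<and> dist y x < infdist x (S (t n)) + t n"
      proof (cases "S (t n) = {}")
        case False
        have "(INF a\<in>S (t n). dist x a) < infdist x (S (t n)) + t n"
          using t(1) False by (simp add: infdist_notempty)
        then obtain y where "y \<in> S (t n)" "dist x y < infdist x (S (t n)) + t n"
          using False by (subst (asm) cINF_less_iff) auto
        then show ?thesis by (auto simp: dist_commute)
      qed auto
    qed
    then obtain X where X: "\<And>n. S (t n) \<noteq> {} \<Longrightarrow> X n \<in> S (t n)"
        "\<And>n. S (t n) \<noteq> {} \<Longrightarrow> dist (X n) x < infdist x (S (t n)) + t n"
      by blast
    have "\<forall>\<^sub>F n in sequentially. dist (X n) x < e" if "e > 0" for e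
    proof -
      have "\<forall>\<^sub>F n in sequentially. t n < e / 2"
        using order_tendstoD(2)[OF t(2), of "e/2"] that by auto
      moreover have "\<forall>\<^sub>F n in sequentially. \<exists>s\<in>S (t n). dist s x < e / 2"
        by (rule ev') (use that in simp)
      ultimately show ?thesis
      proof eventually_elim
        case (elim n)
        then obtain s where s: "s \<in> S (t n)" "dist s x < e / 2" by blast
        have "infdist x (S (t n)) \<le> dist s x"
          using infdist_le[OF s(1), of x] by (simp add: dist_commute)
        moreover have "dist (X n) x < infdist x (S (t n)) + t n"
          by (rule X(2)) (use s in blast)
        ultimately show ?case using s(2) elim(1) by linarith
      qed
    qed
    then have "X \<longlonglongrightarrow> x" by (rule tendstoI)
    moreover obtain N where "\<forall>n\<ge>N. S (t n) \<noteq> {}"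
      using ev'[of 1] unfolding eventually_sequentially by fastforce
    ultimately show "\<exists>X N. X \<longlonglongrightarrow> x \<and> (\<forall>n\<ge>N. X n \<in> S (t n))"
      using X(1) by blast
  qed
qed

lemma epi_M_lim: "epi (M_lim F) = liminf_set (\<lambda>\<tau>. epi (F \<tau>))"
proof -
  define L where "L = liminf_set (\<lambda>\<tau>. epi (F \<tau>))"
  define g where "g x = (INF r\<in>{r. (x, r) \<in> L}. ereal r)" for x
  have up: "(x, r') \<in> L" if "(x, r) \<in> L" "r \<le> r'" for x r r'
    unfolding L_def liminf_set_iff
  proof (intro allI impI)
    fix e :: real assume "e > 0"
    then have "\<forall>\<^sub>F \<tau> in at_right 0. \<exists>s\<in>epi (F \<tau>). dist s (x, r) < e"
      using that(1) unfolding L_def liminf_set_iff by blast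
    then show "\<forall>\<^sub>F \<tau> in at_right 0. \<exists>s\<in>epi (F \<tau>). dist s (x, r') < e"
    proof eventually_elim
      case (elim \<tau>)
      then obtain y q where yq: "(y, q) \<in> epi (F \<tau>)" "dist (y, q) (x, r) < e" by auto
      have "ereal q \<le> ereal (q + (r' - r))" using that(2) by simp
      then have "(y, q + (r' - r)) \<in> epi (F \<tau>)"
        using yq(1) unfolding epi_def by (auto intro: order_trans)
      moreover have "dist (y, q + (r' - r)) (x, r') = dist (y, q) (x, r)"
        by (simp add: dist_prod_def dist_real_def)
      ultimately show ?case using yq(2) by metis
    qed
  qed
  have cl: "(x, r) \<in> L" if "\<And>e. e > 0 \<Longrightarrow> (x, r + e) \<in> L" for x r
    unfolding L_def liminf_set_iff
  proof (intro allI impI)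
    fix e :: real assume "e > 0"
    then have "\<forall>\<^sub>F \<tau> in at_right 0. \<exists>s\<in>epi (F \<tau>). dist s (x, r + e / 2) < e / 2"
      using that[of "e/2"] unfolding L_def liminf_set_iff
      by (meson half_gt_zero)
    then show "\<forall>\<^sub>F \<tau> in at_right 0. \<exists>s\<in>epi (F \<tau>). dist s (x, r) < e"
    proof eventually_elim
      case (elim \<tau>)
      then obtain s where s: "s \<in> epi (F \<tau>)" "dist s (x, r + e / 2) < e / 2" by auto
      have "dist (x, r + e / 2) (x, r) = e / 2"
        using \<open>e > 0\<close> by (simp add: dist_prod_def dist_real_def)
      then have "dist s (x, r) < e"
        using dist_triangle[of s "(x, r)" "(x, r + e / 2)"] s(2) by linarith
      then show ?case using s(1) by blast
    qed
  qed
  have "epi g = L"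
  proof (intro set_eqI, clarify)
    fix x and r :: real
    show "(x, r) \<in> epi g \<longleftrightarrow> (x, r) \<in> L"
    proof
      assume "(x, r) \<in> L"
      then show "(x, r) \<in> epi g" by (auto simp: epi_def g_def intro: INF_lower)
    next
      assume g: "(x, r) \<in> epi g"
      show "(x, r) \<in> L"
      proof (rule cl)
        fix e :: real assume "e > 0"
        then have "g x < ereal (r + e)"
          using g by (auto simp: epi_def intro: le_less_trans)
        then obtain q where "(x, q) \<in> L" "q < r + e"
          unfolding g_def INF_less_iff by auto
        then show "(x, r + e) \<in> L" using up by auto
      qed
    qed
  qed
  then have "epi (THE g. epi g = L) = L"
    by (rule theI[where P = "\<lambda>g. epi g = L"]) (use \<open>epi g = L\<close> epi_inject in metis)
  then show ?thesis by (simp add: M_lim_def L_def)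
qed

text \<open>Functions with values in \<open>\<real> \<union> {+\<infinity>}\<close> are represented as \<^typ>\<open>ereal\<close>-valued functions
  that never take the value \<open>-\<infinity>\<close>.\<close>

definition Gamma0 :: "('a::real_inner \<Rightarrow> ereal) set" where
  "Gamma0 = {f. (\<forall>x. f x \<noteq> -\<infinity>) \<and> (\<exists>x. f x \<noteq> \<infinity>) \<and>
      (\<forall>x. f x \<le> Liminf (at x) f) \<and>
      (\<forall>x y u. 0 < u \<and> u < 1 \<longrightarrow>
         f ((1 - u) *\<^sub>R x + u *\<^sub>R y) \<le> ereal (1 - u) * f x + ereal u * f y)}"

definition Gamma0_t :: "(real \<Rightarrow> 'a::real_inner \<Rightarrow> ereal) set" where
  "Gamma0_t = {f. \<forall>t\<ge>0. f t \<in> Gamma0}"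

text \<open>At a point where \<open>f\<close> is \<open>\<infinity>\<close>, the subdifferential of a proper function is empty: take
  \<open>z\<close> with \<open>f z\<close> finite. The convention \<open>\<infinity> - \<infinity> = \<infinity>\<close> of \<^typ>\<open>ereal\<close> only affects points
  \<open>z\<close> with \<open>f z = \<infinity>\<close>, which impose no constraint.\<close>

definition subdifferential :: "('a::real_inner \<Rightarrow> ereal) \<Rightarrow> 'a \<Rightarrow> 'a set" where
  "subdifferential f x = {y. \<forall>z. ereal (y \<bullet> (z - x)) \<le> f z - f x}"

definition finite_dom :: "(real \<Rightarrow> 'a \<Rightarrow> ereal) \<Rightarrow> 'a set" where
  "finite_dom f = {x. \<forall>t\<ge>0. \<bar>f t x\<bar> \<noteq> \<infinity>}"

definition strongly_monotone :: "real \<Rightarrow> ('a::real_inner \<Rightarrow> 'a) \<Rightarrow> bool" where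
  "strongly_monotone \<alpha> A \<longleftrightarrow>
     (\<forall>x1 x2. (A x2 - A x1) \<bullet> (x2 - x1) \<ge> \<alpha> * (norm (x2 - x1))\<^sup>2)"

definition A_class :: "('a::real_inner \<Rightarrow> 'a) set" where
  "A_class = {A. (\<exists>M. M-lipschitz_on UNIV A) \<and> (\<exists>\<alpha>>0. strongly_monotone \<alpha> A)}"

definition A_class_t :: "(real \<Rightarrow> 'a::real_inner \<Rightarrow> 'a) set" where
  "A_class_t = {A. \<forall>t\<ge>0. A t \<in> A_class}"

definition A_class_unif :: "(real \<Rightarrow> 'a::real_inner \<Rightarrow> 'a) set" where
  "A_class_unif = {A. \<exists>M \<alpha>. \<alpha> > 0 \<and>
      (\<forall>t\<ge>0. M-lipschitz_on UNIV (A t) \<and> strongly_monotone \<alpha> (A t))}"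

text \<open>The value at \<open>x\<close> of \<open>(A + \<partial>f)\<^sup>-\<^sup>1\<close>, which is single-valued and everywhere defined
  for \<open>A\<close> in \<open>A_class\<close> and \<open>f\<close> in \<open>Gamma0\<close> on a Hilbert space.\<close>

definition prox :: "('a::real_inner \<Rightarrow> 'a) \<Rightarrow> ('a \<Rightarrow> ereal) \<Rightarrow> 'a \<Rightarrow> 'a" where
  "prox A f x = (THE y. x \<in> {A y + v |v. v \<in> subdifferential f y})"

definition semi_quotient ::
    "(real \<Rightarrow> 'a::real_inner \<Rightarrow> 'a) \<Rightarrow> 'a \<Rightarrow> real \<times> 'a \<Rightarrow> 'a" where
  "semi_quotient A x = (\<lambda>(\<tau>, w'). (A \<tau> (x + \<tau> *\<^sub>R w') - A 0 x) /\<^sub>R \<tau>)"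

definition semi_differentiable :: "(real \<Rightarrow> 'a::real_inner \<Rightarrow> 'a) \<Rightarrow> 'a \<Rightarrow> bool" where
  "semi_differentiable A x \<longleftrightarrow>
     (\<forall>w. \<exists>l. (semi_quotient A x \<longlongrightarrow> l) (at_right 0 \<times>\<^sub>F nhds w))"

definition semi_deriv :: "(real \<Rightarrow> 'a::real_inner \<Rightarrow> 'a) \<Rightarrow> 'a \<Rightarrow> 'a \<Rightarrow> 'a" where
  "semi_deriv A x w = Lim (at_right 0 \<times>\<^sub>F nhds w) (semi_quotient A x)"

definition second_quotient ::
    "(real \<Rightarrow> 'a::real_inner \<Rightarrow> ereal) \<Rightarrow> 'a \<Rightarrow> 'a \<Rightarrow> real \<Rightarrow> 'a \<Rightarrow> ereal" where
  "second_quotient f x v \<tau> w =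
     (f \<tau> (x + \<tau> *\<^sub>R w) - f \<tau> x - ereal (\<tau> * (v \<bullet> w))) / ereal (\<tau>\<^sup>2)"

definition twice_epi_differentiable ::
    "(real \<Rightarrow> 'a::real_inner \<Rightarrow> ereal) \<Rightarrow> 'a \<Rightarrow> 'a \<Rightarrow> bool" where
  "twice_epi_differentiable f x v \<longleftrightarrow>
     x \<in> finite_dom f \<and> v \<in> subdifferential (f 0) x \<and> M_convergent (second_quotient f x v)"

definition second_epi_deriv ::
    "(real \<Rightarrow> 'a::real_inner \<Rightarrow> ereal) \<Rightarrow> 'a \<Rightarrow> 'a \<Rightarrow> 'a \<Rightarrow> ereal" where
  "second_epi_deriv f x v = M_lim (second_quotient f x v)"

end

(*
The difference quotients w(\<tau>) = (y(\<tau>) - y(0)) / \<tau> solve the rescaled inclusions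
\<xi>(\<tau>) \<in> B(\<tau>, w) + \<partial>\<phi>(\<tau>, w), where \<xi>(\<tau>) is the difference quotient of x, B(\<tau>, _) that of A,
and \<phi>(\<tau>, _) the second-order difference quotient of f. Let w0 solve the limit inclusion. Testing the
rescaled inclusion against a recovery sequence z(\<tau>) \<rightarrow> w0, strong monotonicity gives
\<alpha> |w - z|^2 \<le> <\<xi> - B z, w - z> + \<phi>(z) - \<phi>(w). Convexity and strong epi-convergence bound \<phi>
below by a uniform cone, so w is bounded. Along a subsequence w converges weakly and \<phi>(w)
converges; Mosco convergence puts the limit in the limiting epigraph, and minimality of w0 makes
the limit of the right-hand side nonpositive, whence w \<rightarrow> w0 strongly.
*)
theory Submission
  imports Defs "HOL-Library.Diagonal_Subsequence"
begin

section \<open>Supporting affine functions in Hilbert space\<close>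

text \<open>For \<open>S\<close> the epigraph of a proper function, this says that \<open>v\<close> is a subgradient at \<open>y\<close>, where
  the function has the value \<open>r\<close>. Working with epigraphs avoids extended real arithmetic.\<close>

definition supports :: "('a::real_inner \<times> real) set \<Rightarrow> 'a \<Rightarrow> 'a \<Rightarrow> real \<Rightarrow> bool" where
  "supports S v y r \<longleftrightarrow> (y, r) \<in> S \<and> (\<forall>z s. (z, s) \<in> S \<longrightarrow> r + v \<bullet> (z - y) \<le> s)"

text \<open>Turns minimality along a segment into a first-order condition: \<open>u * b\<close>
  collects the second-order remainder, which disappears as \<open>u\<close> decreases to 0.\<close>

lemma nonneg_if_small_perturbations_nonneg:
  fixes a b :: real
  assumes "\<And>u. 0 < u \<Longrightarrow> u < 1 \<Longrightarrow> 0 \<le> a + u * b"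
  shows "0 \<le> a"
proof -
  have "((\<lambda>u. a + u * b) \<longlongrightarrow> a + 0 * b) (at_right 0)"
    by (intro tendsto_intros)
  moreover have "\<forall>\<^sub>F u in at_right 0. 0 \<le> a + u * b"
    unfolding eventually_at_right_field using assms by (intro exI[of _ 1]) auto
  ultimately show ?thesis
    using tendsto_lowerbound[of "\<lambda>u. a + u * b" a "at_right 0" 0] by simp
qed

text \<open>Minimise height plus \<open>k / 2\<close> times the squared distance to \<open>x\<close>
  over \<open>S\<close>. The quadratic term is uniformly convex, so minimising sequences are Cauchy
  and completeness gives a minimiser; its first-order condition is the support with slope
  \<open>k *\<^sub>R (x - y)\<close>. Projections, Riesz vectors and resolvents all come from this
  one minimisation.\<close>

lemma exists_resolvent_supports:
  fixes S :: "('a::{real_inner, complete_space} \<times> real) set"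
  assumes "closed S" "convex S" "S \<noteq> {}" "k > 0"
    and bound: "\<And>y r. (y, r) \<in> S \<Longrightarrow> c \<le> r + k / 2 * (norm (y - x))\<^sup>2"
  shows "\<exists>y r. supports S (k *\<^sub>R (x - y)) y r"
proof -
  define q :: "'a \<times> real \<Rightarrow> real" where "q p = snd p + k / 2 * (norm (fst p - x))\<^sup>2" for p
  define m where "m = Inf (q ` S)"
  have bdd: "bdd_below (q ` S)"
    by (rule bdd_belowI[of _ c]) (use bound in \<open>force simp: q_def\<close>)
  have m: "m \<le> q p" if "p \<in> S" for p
    unfolding m_def using bdd that by (simp add: cINF_lower)
  have "\<exists>p\<in>S. q p < m + inverse (real (Suc n))" for n
  proof -
    have "Inf (q ` S) < m + inverse (real (Suc n))"
      by (simp add: m_def)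
    then show ?thesis
      using assms(3) bdd by (subst (asm) cInf_less_iff) auto
  qed
  then obtain p where p: "\<And>n. p n \<in> S" "\<And>n. q (p n) < m + inverse (real (Suc n))"
    by metis
  define Y R where "Y n = fst (p n)" and "R n = snd (p n)" for n
  \<comment> \<open>Parallelogram law: the midpoint lies in \<open>S\<close>, so its
    \<open>q\<close>-value is at least \<open>m\<close>, yet it falls below the average of
    \<open>q a\<close> and \<open>q b\<close> by a multiple of the squared distance.\<close>
  have mid: "k / 4 * (norm (fst a - fst b))\<^sup>2 \<le> (q a - m) + (q b - m)" if "a \<in> S" "b \<in> S" for a b
  proof -
    have "(1/2) *\<^sub>R a + (1/2) *\<^sub>R b \<in> S"
      using \<open>convex S\<close> that by (intro convexD) auto
    then have "m \<le> q ((1/2) *\<^sub>R a + (1/2) *\<^sub>R b)" by (rule m)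
    also have "\<dots> = (q a + q b) / 2 - k / 8 * (norm (fst a - fst b))\<^sup>2"
      unfolding q_def power2_norm_eq_inner
      by (simp add: inner_simps inner_commute field_simps)
    finally show ?thesis by (simp add: field_simps)
  qed
  have "Cauchy Y"
  proof (rule metric_CauchyI)
    fix e :: real assume "e > 0"
    then have "k / 8 * e\<^sup>2 > 0" using \<open>k > 0\<close> by simp
    then obtain N where N: "inverse (real (Suc N)) < k / 8 * e\<^sup>2"
      using reals_Archimedean by blast
    have "dist (Y i) (Y j) < e" if "i \<ge> N" "j \<ge> N" for i j
    proof -
      have le: "inverse (real (Suc n)) \<le> inverse (real (Suc N))" if "n \<ge> N" for n
        using that by (intro le_imp_inverse_le) auto
      have "k / 4 * (norm (Y i - Y j))\<^sup>2 < k / 4 * e\<^sup>2"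
        using mid[OF p(1)[of i] p(1)[of j]] p(2)[of i] p(2)[of j] le[OF that(1)] le[OF that(2)] N
        unfolding Y_def by linarith
      then have "(norm (Y i - Y j))\<^sup>2 < e\<^sup>2" using \<open>k > 0\<close> by simp
      then show ?thesis
        using \<open>e > 0\<close> by (simp add: dist_norm power_less_imp_less_base)
    qed
    then show "\<exists>M. \<forall>i\<ge>M. \<forall>j\<ge>M. dist (Y i) (Y j) < e" by blast
  qed
  then obtain y where y: "Y \<longlonglongrightarrow> y"
    using Cauchy_convergent convergent_def by blast
  \<comment> \<open>The height for which \<open>q (y, r) = m\<close>. The heights \<open>R n\<close>
    are forced to converge to it, because \<open>q (p n)\<close> and \<open>Y n\<close>
    converge.\<close>
  define r where "r = m - k / 2 * (norm (y - x))\<^sup>2"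
  have "(\<lambda>n. m + inverse (real (Suc n))) \<longlonglongrightarrow> m + 0"
    by (intro tendsto_intros LIMSEQ_inverse_real_of_nat)
  then have qlim: "(\<lambda>n. q (p n)) \<longlonglongrightarrow> m"
    by (intro tendsto_sandwich[OF _ _ tendsto_const, of m "\<lambda>n. q (p n)" _ "\<lambda>n. m + inverse (real (Suc n))"])
      (use m p in \<open>auto intro!: always_eventually less_imp_le\<close>)
  have "(\<lambda>n. q (p n) - k / 2 * (norm (Y n - x))\<^sup>2) \<longlonglongrightarrow> r"
    unfolding r_def by (intro tendsto_intros qlim y)
  then have "R \<longlonglongrightarrow> r" by (simp add: q_def Y_def R_def[abs_def])
  with y have "(\<lambda>n. (Y n, R n)) \<longlonglongrightarrow> (y, r)" by (rule tendsto_Pair)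
  from closed_sequentially[OF \<open>closed S\<close> _ this] have yr: "(y, r) \<in> S"
    using p(1) by (simp add: Y_def R_def)
  have "r + (k *\<^sub>R (x - y)) \<bullet> (z - y) \<le> s" if zs: "(z, s) \<in> S" for z s
  proof -
    \<comment> \<open>Compare the minimiser with the point at parameter \<open>u\<close> on the
      segment towards \<open>(z, s)\<close>, and divide the resulting inequality by
      \<open>u\<close>.\<close>
    have "0 \<le> (s - r - k * ((x - y) \<bullet> (z - y))) + u * (k / 2 * (norm (z - y))\<^sup>2)"
      if u: "0 < u" "u < 1" for u
    proof -
      have "(1 - u) *\<^sub>R (y, r) + u *\<^sub>R (z, s) \<in> S"
        using \<open>convex S\<close> yr zs u by (intro convexD) auto
      from m[OF this] have "r + k / 2 * (norm (y - x))\<^sup>2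
          \<le> (1 - u) * r + u * s + k / 2 * (norm ((1 - u) *\<^sub>R y + u *\<^sub>R z - x))\<^sup>2"
        by (simp add: q_def r_def)
      also have "(1 - u) *\<^sub>R y + u *\<^sub>R z - x = (y - x) + u *\<^sub>R (z - y)"
        by (simp add: algebra_simps)
      also have "(norm \<dots>)\<^sup>2 = (norm (y - x))\<^sup>2 - 2 * u * ((x - y) \<bullet> (z - y)) + u\<^sup>2 * (norm (z - y))\<^sup>2"
        unfolding power2_norm_eq_inner
        by (simp add: inner_simps inner_commute power2_eq_square algebra_simps)
      finally have "0 \<le> u * ((s - r - k * ((x - y) \<bullet> (z - y))) + u * (k / 2 * (norm (z - y))\<^sup>2))"
        by (simp add: algebra_simps power2_eq_square)
      then show ?thesis using u by (simp add: zero_le_mult_iff)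
    qed
    from nonneg_if_small_perturbations_nonneg[OF this] show ?thesis by simp
  qed
  then show ?thesis using yr unfolding supports_def by blast
qed

text \<open>A lower bound on a ball spreads to a cone: a point of the segment from
  \<open>(z, l)\<close> to \<open>(y, r)\<close> lies over the ball, so its height is at least
  \<open>m\<close>, and this can be solved for \<open>r\<close>.\<close>

lemma convex_minorant:
  fixes S :: "('a::real_normed_vector \<times> real) set"
  assumes "convex S" "(z, l) \<in> S" "d > 0"
    and near: "\<And>y r. (y, r) \<in> S \<Longrightarrow> norm (y - z) < d \<Longrightarrow> m \<le> r"
    and yr: "(y, r) \<in> S"
  shows "m - (l - m) / d * norm (y - z) \<le> r"
proof -
  \<comment> \<open>This \<open>u\<close> puts the intermediate point at distance
    \<open>d * e / (d + e) < d\<close> from \<open>z\<close>, for near and far \<open>y\<close>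
    alike, including \<open>e = 0\<close>.\<close>
  define e u where "e = norm (y - z)" and "u = d / (d + e)"
  have e: "e \<ge> 0" by (simp add: e_def)
  then have u: "0 < u" "u \<le> 1" using \<open>d > 0\<close> by (auto simp: u_def)
  have S: "(1 - u) *\<^sub>R (z, l) + u *\<^sub>R (y, r) \<in> S"
    using assms u by (intro convexD) auto
  have "norm ((1 - u) *\<^sub>R z + u *\<^sub>R y - z) = norm (u *\<^sub>R (y - z))"
    by (simp add: algebra_simps)
  also have "\<dots> = u * e" using u by (simp add: e_def)
  also have "\<dots> < d" using \<open>d > 0\<close> e by (simp add: u_def field_simps)
  finally have "m \<le> (1 - u) * l + u * r" using near S by simp
  also have "\<dots> = (e * l + d * r) / (d + e)"
  proof -
    have "1 - u = e / (d + e)" using \<open>d > 0\<close> e by (simp add: u_def field_simps)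
    then show ?thesis by (simp add: u_def add_divide_distrib)
  qed
  finally have "m * (d + e) \<le> e * l + d * r" using \<open>d > 0\<close> e by (simp add: pos_le_divide_eq)
  then show ?thesis using \<open>d > 0\<close> by (simp add: e_def[symmetric] field_simps)
qed

section \<open>Orthogonal projection and Riesz representation\<close>

text \<open>Over \<open>V \<times> {0}\<close> the height vanishes, and a support is the variational
  inequality of the projection. Testing it with \<open>p + v\<close> and \<open>p - v\<close> yields
  orthogonality.\<close>

lemma exists_projection_subspace:
  fixes V :: "'a::{real_inner, complete_space} set"
  assumes "closed V" "subspace V"
  shows "\<exists>p\<in>V. \<forall>v\<in>V. (h - p) \<bullet> v = 0"
proof -
  have "\<exists>y r. supports (V \<times> {0}) (1 *\<^sub>R (h - y)) y r"
  proof (rule exists_resolvent_supports[where c = 0])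
    show "closed (V \<times> {0::real})" using assms by (intro closed_Times) auto
    show "convex (V \<times> {0::real})" using assms by (intro convex_Times subspace_imp_convex) auto
    show "V \<times> {0::real} \<noteq> {}" using assms subspace_0 by blast
  qed auto
  then obtain p where p: "p \<in> V" "\<And>z. z \<in> V \<Longrightarrow> (h - p) \<bullet> (z - p) \<le> 0"
    unfolding supports_def by auto
  have "(h - p) \<bullet> v = 0" if "v \<in> V" for v
    using p(2)[of "p + v"] p(2)[of "p - v"] assms that p(1)
    by (auto simp: subspace_add subspace_diff)
  then show ?thesis using p(1) by blast
qed

text \<open>The representing vector minimises \<open>1 / 2 * (norm h)\<^sup>2 - L h\<close>, so the
  resolvent lemma is applied at 0 to the graph of \<open>- L\<close>. Completing the square with the
  bound \<open>K\<close> supplies the lower bound.\<close>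

lemma riesz_representation:
  fixes L :: "'a::{real_inner, complete_space} \<Rightarrow> real"
  assumes "bounded_linear L"
  shows "\<exists>y. \<forall>h. L h = y \<bullet> h"
proof -
  interpret L: bounded_linear L by fact
  obtain K where K: "\<And>h. norm (L h) \<le> norm h * K" using L.bounded by blast
  let ?S = "range (\<lambda>h. (h, - L h))"
  have "\<exists>y r. supports ?S (1 *\<^sub>R (0 - y)) y r"
  proof (rule exists_resolvent_supports[where c = "- K\<^sup>2 / 2"])
    have "closed {p. snd p = - L (fst p)}"
      by (intro closed_Collect_eq continuous_intros L.continuous_on)
    also have "{p. snd p = - L (fst p)} = ?S" by force
    finally show "closed ?S" .
    have "linear (\<lambda>h. (h, - L h))"
      by (rule linearI) (auto simp: L.add L.scaleR)
    then show "convex ?S"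
      using convex_linear_image[OF _ convex_UNIV] by blast
  next
    fix y r assume "(y, r) \<in> ?S"
    then have "r = - L y" by auto
    then have "- (norm y * K) \<le> r" using K[of y] by simp
    moreover have "0 \<le> (norm y - K)\<^sup>2" by simp
    ultimately show "- K\<^sup>2 / 2 \<le> r + 1 / 2 * (norm (y - 0))\<^sup>2"
      by (simp add: power2_eq_square algebra_simps)
  qed auto
  then obtain y r where yr: "supports ?S (- y) y r" by auto
  have y: "- L y + (- y) \<bullet> (h - y) \<le> - L h" for h
  proof -
    have "r = - L y" using yr by (auto simp: supports_def)
    moreover have "r + (- y) \<bullet> (h - y) \<le> - L h"
      using yr unfolding supports_def by blast
    ultimately show ?thesis by simp
  qed
  \<comment> \<open>By linearity of \<open>L\<close>, the opposite directions \<open>h\<close> and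
    \<open>- h\<close> turn the support inequality into an equality.\<close>
  have "L h = y \<bullet> h" for h
    using y[of "y + h"] y[of "y - h"] by (simp add: L.add L.diff)
  then show ?thesis by blast
qed

section \<open>Weak sequential compactness\<close>

text \<open>A diagonal subsequence makes the inner products with every \<open>X n\<close> converge.
  Convergence then extends to all test vectors, and Riesz representation turns the limit functional
  into the weak limit.\<close>

lemma bounded_imp_weakly_convergent_subsequence:
  fixes X :: "nat \<Rightarrow> 'a::{real_inner, complete_space}"
  assumes "bounded (range X)"
  shows "\<exists>l r. strict_mono r \<and> weakly_tendsto (X \<circ> r) l"
proof -
  obtain K where K: "K > 0" "\<And>n. norm (X n) \<le> K"
    using assms unfolding bounded_pos by auto
  have inner_K: "\<bar>X n \<bullet> h\<bar> \<le> K * norm h" for n h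
    using Cauchy_Schwarz_ineq2[of "X n" h] K(2)[of n] mult_right_mono[of _ K "norm h"]
    by (metis norm_ge_zero order_trans)
  interpret subseqs "\<lambda>n s. convergent (\<lambda>k. X (s k) \<bullet> X n)"
  proof
    fix n and s :: "nat \<Rightarrow> nat"
    have "bounded (range (\<lambda>k. X (s k) \<bullet> X n))"
      unfolding bounded_iff using inner_K by auto
    then obtain l r where "strict_mono r" "((\<lambda>k. X (s k) \<bullet> X n) \<circ> r) \<longlonglongrightarrow> l"
      using bounded_imp_convergent_subsequence by blast
    then show "\<exists>r'. strict_mono r' \<and> convergent (\<lambda>k. X ((s \<circ> r') k) \<bullet> X n)"
      by (auto simp: o_def convergent_def)
  qed
  define r where "r = diagseq"
  have r: "strict_mono r" by (simp add: r_def subseq_diagseq)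
  have conv: "convergent (\<lambda>k. X (r k) \<bullet> X n)" for n
  proof -
    have "convergent (\<lambda>k. X ((diagseq \<circ> (+) (Suc n)) k) \<bullet> X n)"
    proof (rule diagseq_holds)
      fix q s :: "nat \<Rightarrow> nat" and n
      assume "strict_mono q" "convergent (\<lambda>k. X (s k) \<bullet> X n)"
      then show "convergent (\<lambda>k. X ((s \<circ> q) k) \<bullet> X n)"
        using convergent_subseq_convergent[of "\<lambda>k. X (s k) \<bullet> X n" q] by (simp add: o_def)
    qed
    then have "convergent (\<lambda>k. X (r (k + Suc n)) \<bullet> X n)"
      by (simp add: r_def o_def add.commute)
    then show ?thesis
      using convergent_ignore_initial_segment[of "\<lambda>k. X (r k) \<bullet> X n" "Suc n"] by simp
  qed
  \<comment> \<open>Projecting onto the closed subspace of good test vectors, which contains every \<open>X n\<close>,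
    makes separability of the space unnecessary.\<close>
  define V where "V = {h. convergent (\<lambda>k. X (r k) \<bullet> h)}"
  have "subspace V"
    unfolding subspace_def V_def
    by (auto simp: inner_add_right intro: convergent_add convergent_mult convergent_const)
  moreover have "closed V"
    unfolding closed_sequential_limits
  proof (intro allI impI, elim conjE)
    fix H h assume H: "\<forall>n. H n \<in> V" "H \<longlonglongrightarrow> h"
    have "Cauchy (\<lambda>k. X (r k) \<bullet> h)"
    proof (rule metric_CauchyI)
      fix e :: real assume "e > 0"
      \<comment> \<open>Replacing \<open>h\<close> by \<open>H m\<close> in two inner products costs
        less than \<open>e / 4\<close> each, and the Cauchy tail for \<open>H m\<close> costs
        another \<open>e / 4\<close>.\<close>
      then have "e / (4 * K) > 0" using K by simp
      then obtain m where "dist (H m) h < e / (4 * K)"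
        using H(2) unfolding lim_sequentially by blast
      then have "K * norm (H m - h) < e / 4"
        using K(1) by (simp add: dist_norm field_simps)
      then have close: "\<bar>X n \<bullet> (H m - h)\<bar> < e / 4" for n
        using inner_K[of n "H m - h"] by linarith
      have "Cauchy (\<lambda>k. X (r k) \<bullet> H m)"
        using H(1) convergent_Cauchy by (auto simp: V_def)
      then obtain N where N: "\<And>i j. i \<ge> N \<Longrightarrow> j \<ge> N \<Longrightarrow> dist (X (r i) \<bullet> H m) (X (r j) \<bullet> H m) < e / 4"
        using \<open>e > 0\<close> by (metis metric_CauchyD zero_less_divide_iff zero_less_numeral)
      have "dist (X (r i) \<bullet> h) (X (r j) \<bullet> h) < e" if "i \<ge> N" "j \<ge> N" for i j
        using N[OF that] close[of "r i"] close[of "r j"]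
        unfolding dist_real_def inner_diff_right by linarith
      then show "\<exists>M. \<forall>i\<ge>M. \<forall>j\<ge>M. dist (X (r i) \<bullet> h) (X (r j) \<bullet> h) < e" by blast
    qed
    then show "h \<in> V" by (simp add: V_def Cauchy_convergent_iff)
  qed
  ultimately have "h \<in> V" for h
  proof -
    obtain p where p: "p \<in> V" "\<And>v. v \<in> V \<Longrightarrow> (h - p) \<bullet> v = 0"
      using exists_projection_subspace[OF \<open>closed V\<close> \<open>subspace V\<close>] by blast
    have "X n \<bullet> h = X n \<bullet> p" for n
    proof -
      have "(h - p) \<bullet> X n = 0" using conv by (intro p(2)) (simp add: V_def)
      then show ?thesis by (simp add: inner_diff_left inner_commute[of "X n"])
    qed
    then show ?thesis using p(1) by (simp add: V_def)
  qed
  then have lim: "(\<lambda>k. X (r k) \<bullet> h) \<longlonglongrightarrow> lim (\<lambda>k. X (r k) \<bullet> h)" for h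
    by (simp add: V_def convergent_LIMSEQ_iff)
  have "bounded_linear (\<lambda>h. lim (\<lambda>k. X (r k) \<bullet> h))"
  proof (rule bounded_linear_intro)
    show "lim (\<lambda>k. X (r k) \<bullet> (a + b)) = lim (\<lambda>k. X (r k) \<bullet> a) + lim (\<lambda>k. X (r k) \<bullet> b)" for a b
      by (rule limI) (simp add: inner_add_right tendsto_add lim)
    show "lim (\<lambda>k. X (r k) \<bullet> (c *\<^sub>R a)) = c *\<^sub>R lim (\<lambda>k. X (r k) \<bullet> a)" for c a
      by (rule limI) (simp add: tendsto_mult lim)
    show "norm (lim (\<lambda>k. X (r k) \<bullet> a)) \<le> norm a * K" for a
      by (rule LIMSEQ_le_const2[OF tendsto_norm[OF lim]])
         (use inner_K in \<open>auto simp: mult.commute\<close>)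
  qed
  then obtain l where "\<And>h. lim (\<lambda>k. X (r k) \<bullet> h) = l \<bullet> h"
    using riesz_representation by blast
  then have "weakly_tendsto (X \<circ> r) l"
    using lim by (simp add: weakly_tendsto_def)
  with r show ?thesis by blast
qed

lemma tendsto_weakly_tendsto:
  assumes "X \<longlonglongrightarrow> x" shows "weakly_tendsto X x"
  unfolding weakly_tendsto_def using assms by (auto intro: tendsto_intros)

lemma weakly_tendsto_subseq:
  assumes "weakly_tendsto X x" "strict_mono r" shows "weakly_tendsto (X \<circ> r) x"
  using assms LIMSEQ_subseq_LIMSEQ[of _ _ r] unfolding weakly_tendsto_def by (auto simp: o_def)

lemma weakly_tendsto_Pair:
  fixes b :: "nat \<Rightarrow> real"
  assumes "weakly_tendsto X x" "b \<longlonglongrightarrow> c"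
  shows "weakly_tendsto (\<lambda>n. (X n, b n)) (x, c)"
  using assms unfolding weakly_tendsto_def by (auto simp: inner_prod_def intro!: tendsto_add tendsto_mult_right)

text \<open>Strong times weak: in \<open>(g n - p) \<bullet> X n + X n \<bullet> p\<close> the norm
  bound kills the first summand and weak convergence handles the second.\<close>

lemma tendsto_inner_weakly_tendsto:
  assumes "weakly_tendsto X x" "\<And>n. norm (X n) \<le> K" "g \<longlonglongrightarrow> p"
  shows "(\<lambda>n. g n \<bullet> X n) \<longlonglongrightarrow> p \<bullet> x"
proof -
  have "(\<lambda>n. (g n - p) \<bullet> X n) \<longlonglongrightarrow> 0"
  proof (rule Lim_null_comparison)
    show "\<forall>\<^sub>F n in sequentially. norm ((g n - p) \<bullet> X n) \<le> norm (g n - p) * K"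
      using assms(2) by (auto intro!: always_eventually order_trans[OF Cauchy_Schwarz_ineq2] mult_left_mono)
    have "(\<lambda>n. norm (g n - p) * K) \<longlonglongrightarrow> norm (p - p) * K"
      by (intro tendsto_intros assms)
    then show "(\<lambda>n. norm (g n - p) * K) \<longlonglongrightarrow> 0" by simp
  qed
  moreover have "(\<lambda>n. X n \<bullet> p) \<longlonglongrightarrow> x \<bullet> p"
    using assms(1) by (simp add: weakly_tendsto_def)
  ultimately have "(\<lambda>n. (g n - p) \<bullet> X n + X n \<bullet> p) \<longlonglongrightarrow> 0 + x \<bullet> p"
    by (rule tendsto_add)
  then show ?thesis by (simp add: inner_diff_left inner_commute[of _ p])
qed

section \<open>Stability under Mosco convergence\<close>

text \<open>\<open>\<xi> \<tau> - B \<tau> w\<close> is the slope prescribed at \<open>w\<close>,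
  and \<open>\<beta> \<tau>\<close> is the lowest height of \<open>S \<tau>\<close> over the
  solution \<open>w \<tau>\<close>. Hypothesis \<open>conv\<close> concerns only arguments
  converging strongly to \<open>w0\<close>: strong monotonicity moves \<open>B\<close> from the
  merely weakly convergent \<open>w\<close> to the recovery sequence. Since \<open>t\<close> is
  arbitrary, convergence along a subsequence suffices for the full limit.\<close>

lemma mosco_stability:
  fixes S :: "real \<Rightarrow> ('a::{real_inner, complete_space} \<times> real) set"
  assumes mosco: "w_limsup_set S \<subseteq> liminf_set S"
    and cvx: "\<And>\<tau>. \<tau> > 0 \<Longrightarrow> convex (S \<tau>)"
    and up: "\<And>\<tau> y r r'. \<tau> > 0 \<Longrightarrow> (y, r) \<in> S \<tau> \<Longrightarrow> r \<le> r' \<Longrightarrow> (y, r') \<in> S \<tau>"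
    and lim: "supports (liminf_set S) p w0 \<mu>"
    and mono: "\<And>\<tau>. \<tau> > 0 \<Longrightarrow> strongly_monotone \<alpha> (B \<tau>)" and "\<alpha> > 0"
    and conv: "\<And>s z. (\<And>n. s n > 0) \<Longrightarrow> s \<longlonglongrightarrow> 0 \<Longrightarrow> z \<longlonglongrightarrow> w0 \<Longrightarrow>
        (\<lambda>n::nat. \<xi> (s n) - B (s n) (z n)) \<longlonglongrightarrow> p"
    and sol: "\<And>\<tau>. \<tau> > 0 \<Longrightarrow> supports (S \<tau>) (\<xi> \<tau> - B \<tau> (w \<tau>)) (w \<tau>) (\<beta> \<tau>)"
    and t: "\<And>n. t n > 0" "t \<longlonglongrightarrow> 0"
  shows "\<exists>r. strict_mono r \<and> (\<lambda>n. w (t (r n))) \<longlonglongrightarrow> w0"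
proof -
  have "(w0, \<mu>) \<in> liminf_set S" using lim by (simp add: supports_def)
  then obtain Z N0 where Z: "Z \<longlonglongrightarrow> (w0, \<mu>)" "\<And>n. n \<ge> N0 \<Longrightarrow> Z n \<in> S (t n)"
    unfolding liminf_set_def using t by blast
  define z l where "z n = fst (Z n)" and "l n = snd (Z n)" for n
  have z: "z \<longlonglongrightarrow> w0" and l: "l \<longlonglongrightarrow> \<mu>"
    using tendsto_fst[OF Z(1)] tendsto_snd[OF Z(1)] by (simp_all add: z_def[abs_def] l_def[abs_def])
  have zl: "(z n, l n) \<in> S (t n)" if "n \<ge> N0" for n
    using Z(2)[OF that] by (simp add: z_def l_def)
  define g where "g n = \<xi> (t n) - B (t n) (z n)" for n
  have g: "g \<longlonglongrightarrow> p" unfolding g_def using conv[OF t z] by simp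
  define D where "D n = norm (w (t n) - z n)" for n
  have D0: "D n \<ge> 0" for n by (simp add: D_def)

  \<comment> \<open>Lower bound near \<open>w0\<close>, uniform in \<open>n\<close>. Otherwise
    points of height below \<open>\<mu> - 1\<close> approach \<open>w0\<close>; their heights may be
    unbounded, so they are lifted to exactly \<open>\<mu> - 1\<close>. The Mosco condition then puts
    \<open>(w0, \<mu> - 1)\<close> in the limit set, below the support at \<open>w0\<close>.\<close>
  have "\<exists>d>0. \<exists>N. \<forall>n\<ge>N. \<forall>y r. (y, r) \<in> S (t n) \<longrightarrow> norm (y - w0) < d \<longrightarrow> \<mu> - 1 \<le> r"
  proof (rule ccontr)
    assume neg: "\<not> ?thesis"
    have "\<exists>n y r. n \<ge> k \<and> (y, r) \<in> S (t n) \<and> norm (y - w0) < inverse (real (Suc k)) \<and> r < \<mu> - 1" for k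
      using neg by (meson inverse_positive_iff_positive not_le of_nat_0_less_iff zero_less_Suc)
    then obtain n y r where nyr: "\<And>k. n k \<ge> k" "\<And>k. (y k, r k) \<in> S (t (n k))"
        "\<And>k. norm (y k - w0) < inverse (real (Suc k))" "\<And>k. r k < \<mu> - 1"
      by metis
    have "(\<lambda>k. y k - w0) \<longlonglongrightarrow> 0"
      by (rule Lim_null_comparison[OF _ LIMSEQ_inverse_real_of_nat])
         (use nyr(3) in \<open>auto intro!: always_eventually less_imp_le\<close>)
    then have "y \<longlonglongrightarrow> w0" by (simp add: LIM_zero_iff)
    then have weak: "weakly_tendsto (\<lambda>k. (y k, \<mu> - 1)) (w0, \<mu> - 1)"
      by (intro tendsto_weakly_tendsto tendsto_intros)
    \<comment> \<open>\<open>n\<close> need not be monotone: the upper limit accepts any positive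
      null sequence of parameters.\<close>
    have "filterlim n at_top sequentially"
      by (rule filterlim_at_top_mono[OF filterlim_ident]) (use nyr in auto)
    then have "(\<lambda>k. t (n k)) \<longlonglongrightarrow> 0" by (rule filterlim_compose[OF t(2)])
    moreover have "(y k, \<mu> - 1) \<in> S (t (n k))" for k
      using up[OF t(1) nyr(2)] nyr(4)[of k] by simp
    ultimately have "(w0, \<mu> - 1) \<in> w_limsup_set S"
      unfolding w_limsup_set_def using t(1) weak
      by (intro CollectI exI[of _ "\<lambda>k. t (n k)"] exI[of _ "\<lambda>k. (y k, \<mu> - 1)"]) auto
    then have "(w0, \<mu> - 1) \<in> liminf_set S" using mosco by blast
    then have "\<mu> + p \<bullet> (w0 - w0) \<le> \<mu> - 1" using lim unfolding supports_def by blast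
    then show False by simp
  qed
  then obtain d N1 where d: "d > 0"
    and near: "\<And>n y r. n \<ge> N1 \<Longrightarrow> (y, r) \<in> S (t n) \<Longrightarrow> norm (y - w0) < d \<Longrightarrow> \<mu> - 1 \<le> r"
    by metis

  \<comment> \<open>Sum of the support inequality at \<open>w (t n)\<close>, tested at
    \<open>(z n, l n)\<close>, and strong monotonicity between \<open>w (t n)\<close> and
    \<open>z n\<close>.\<close>
  have key: "\<alpha> * (D n)\<^sup>2 \<le> g n \<bullet> (w (t n) - z n) + l n - \<beta> (t n)" if "n \<ge> N0" for n
  proof -
    have "\<beta> (t n) + (\<xi> (t n) - B (t n) (w (t n))) \<bullet> (z n - w (t n)) \<le> l n"
      using sol[OF t(1)] zl[OF that] unfolding supports_def by blast
    moreover have "\<alpha> * (D n)\<^sup>2 \<le> (B (t n) (w (t n)) - B (t n) (z n)) \<bullet> (w (t n) - z n)"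
      using mono[OF t(1)] unfolding strongly_monotone_def D_def by blast
    ultimately show ?thesis
      unfolding g_def by (simp add: inner_diff_left inner_diff_right)
  qed

  define G where "G = norm p + 1"
  have G0: "G > 0" unfolding G_def using norm_ge_zero[of p] by linarith
  \<comment> \<open>Bound for \<open>D n\<close> read off from
    \<open>\<alpha> * (D n)\<^sup>2 \<le> (G + 4 / d) * D n + 2\<close>: for \<open>D n > 1\<close>
    divide by \<open>D n\<close>; the summand 1 covers \<open>D n \<le> 1\<close>.\<close>
  define C where "C = (G + 4 / d + 2) / \<alpha> + 1"
  have C0: "C > 0" using G0 d \<open>\<alpha> > 0\<close> by (simp add: C_def add_pos_pos)
  have "\<forall>\<^sub>F n in sequentially. norm (g n) < G"
    by (rule order_tendstoD(2)[OF tendsto_norm[OF g]]) (simp add: G_def)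
  moreover have "\<forall>\<^sub>F n in sequentially. norm (z n - w0) < min 1 (d / 2)"
    using tendstoD[OF z, of "min 1 (d / 2)"] d by (simp add: dist_norm)
  moreover have "\<forall>\<^sub>F n in sequentially. \<bar>l n - \<mu>\<bar> < 1"
    using tendstoD[OF l, of 1] by (simp add: dist_real_def)
  moreover have "\<forall>\<^sub>F n in sequentially. n \<ge> max N0 N1" by (rule eventually_ge_at_top)
  ultimately have "\<forall>\<^sub>F n in sequentially. n \<ge> N0 \<and> norm (w (t n)) \<le> C + norm w0 + 1
      \<and> \<bar>\<beta> (t n)\<bar> \<le> \<bar>\<mu>\<bar> + 1 + 4 / d * C + G * C"
  proof eventually_elim
    case (elim n)
    \<comment> \<open>The ball is recentred at \<open>z n\<close>, over which the height
      \<open>l n\<close> is available. Since \<open>l n - (\<mu> - 1) \<le> 2\<close> and the radius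
      is \<open>d / 2\<close>, the cone has slope at most \<open>4 / d\<close>.\<close>
    have bz: "\<mu> - 1 \<le> r" if "(y, r) \<in> S (t n)" "norm (y - z n) < d / 2" for y r
    proof (rule near[of n])
      show "norm (y - w0) < d"
        using norm_triangle_ineq[of "y - z n" "z n - w0"] that elim by simp
    qed (use that elim in auto)
    have "(w (t n), \<beta> (t n)) \<in> S (t n)" using sol[OF t(1)] by (simp add: supports_def)
    have "\<mu> - 1 - (l n - (\<mu> - 1)) / (d / 2) * D n \<le> \<beta> (t n)"
      unfolding D_def
      by (rule convex_minorant[where S = "S (t n)"])
         (use cvx[OF t(1)] zl bz d elim \<open>(w (t n), \<beta> (t n)) \<in> S (t n)\<close> in auto)
    moreover have "(l n - (\<mu> - 1)) / (d / 2) * D n \<le> 4 / d * D n"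
    proof (rule mult_right_mono[OF _ D0])
      have "(l n - (\<mu> - 1)) / (d / 2) \<le> 2 / (d / 2)" using elim d by (intro divide_right_mono) auto
      then show "(l n - (\<mu> - 1)) / (d / 2) \<le> 4 / d" by simp
    qed
    ultimately have low: "\<mu> - 1 - 4 / d * D n \<le> \<beta> (t n)" by linarith
    have "g n \<bullet> (w (t n) - z n) \<le> norm (g n) * D n"
      unfolding D_def by (rule norm_cauchy_schwarz)
    also have "\<dots> \<le> G * D n" using elim D0[of n] by (intro mult_right_mono) auto
    finally have gD: "g n \<bullet> (w (t n) - z n) \<le> G * D n" .
    have kn: "\<alpha> * (D n)\<^sup>2 \<le> g n \<bullet> (w (t n) - z n) + l n - \<beta> (t n)"
      using key elim by simp
    have "\<alpha> * (D n)\<^sup>2 \<le> (G + 4 / d) * D n + 2"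
      using kn gD low elim unfolding distrib_right by linarith
    have DC: "D n \<le> C"
    proof (cases "D n \<le> 1")
      case True
      then show ?thesis using G0 d \<open>\<alpha> > 0\<close> by (simp add: C_def add_increasing)
    next
      case False
      then have "\<alpha> * D n * D n \<le> (G + 4 / d + 2) * D n"
        using \<open>\<alpha> * (D n)\<^sup>2 \<le> (G + 4 / d) * D n + 2\<close> by (simp add: power2_eq_square algebra_simps)
      then have "\<alpha> * D n \<le> G + 4 / d + 2" using False by simp
      then have "D n \<le> (G + 4 / d + 2) / \<alpha>" using \<open>\<alpha> > 0\<close> by (simp add: field_simps)
      then show ?thesis by (simp add: C_def)
    qed
    have "norm (w (t n)) \<le> D n + norm (z n - w0) + norm w0"
      using norm_triangle_ineq[of "w (t n) - z n" "z n"] norm_triangle_ineq[of "z n - w0" w0]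
      by (simp add: D_def)
    then have "norm (w (t n)) \<le> C + norm w0 + 1" using DC elim by simp
    moreover have "4 / d * D n \<le> 4 / d * C" "G * D n \<le> G * C" "0 \<le> 4 / d * C" "0 \<le> G * C"
      using DC d G0 C0 by (auto intro!: mult_left_mono divide_right_mono)
    \<comment> \<open>With this, \<open>kn\<close> bounds \<open>\<beta> (t n)\<close> from above;
      the cone bound \<open>low\<close> bounds it from below.\<close>
    moreover have "0 \<le> \<alpha> * (D n)\<^sup>2" using \<open>\<alpha> > 0\<close> by simp
    ultimately show ?case using low gD kn elim by (auto simp: abs_le_iff)
  qed
  then obtain M K K' where M: "\<And>n. n \<ge> M \<Longrightarrow> n \<ge> N0"
      "\<And>n. n \<ge> M \<Longrightarrow> norm (w (t n)) \<le> K" "\<And>n. n \<ge> M \<Longrightarrow> \<bar>\<beta> (t n)\<bar> \<le> K'"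
    unfolding eventually_sequentially by metis

  \<comment> \<open>Two successive extractions: weak convergence of \<open>w\<close>, then
    convergence of the real heights \<open>\<beta>\<close>. The shift by \<open>M\<close> discards
    the indices where the bounds may fail.\<close>
  have "bounded (range (\<lambda>n. w (t (n + M))))"
    unfolding bounded_iff using M(2) by (intro exI[of _ K]) auto
  then obtain w1 r1 where r1: "strict_mono r1" "weakly_tendsto ((\<lambda>n. w (t (n + M))) \<circ> r1) w1"
    using bounded_imp_weakly_convergent_subsequence by blast
  have "bounded (range (\<lambda>n. \<beta> (t (r1 n + M))))"
    unfolding bounded_iff using M(3) by (intro exI[of _ K']) auto
  then obtain b r2 where r2: "strict_mono r2" "((\<lambda>n. \<beta> (t (r1 n + M))) \<circ> r2) \<longlonglongrightarrow> b"
    using bounded_imp_convergent_subsequence by blast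
  define r where "r n = r1 (r2 n) + M" for n
  have r: "strict_mono r"
    using r1(1) r2(1) by (auto simp: r_def strict_mono_def)
  have rM: "r n \<ge> M" for n by (simp add: r_def)
  have sub: "(\<lambda>n. h (r n)) \<longlonglongrightarrow> c" if "h \<longlonglongrightarrow> c" for h :: "nat \<Rightarrow> 'b::topological_space" and c
    using LIMSEQ_subseq_LIMSEQ[OF that r] by (simp add: o_def)
  have weak: "weakly_tendsto (\<lambda>n. w (t (r n))) w1"
    using weakly_tendsto_subseq[OF r1(2) r2(1)] by (simp add: o_def r_def)
  have b: "(\<lambda>n. \<beta> (t (r n))) \<longlonglongrightarrow> b" using r2(2) by (simp add: o_def r_def)
  have "(w1, b) \<in> w_limsup_set S"
    unfolding w_limsup_set_def
  proof (intro CollectI exI conjI)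
    show "\<forall>n. 0 < t (r n)" using t by simp
    show "(\<lambda>n. t (r n)) \<longlonglongrightarrow> 0" by (rule sub[OF t(2)])
    show "weakly_tendsto (\<lambda>n. (w (t (r n)), \<beta> (t (r n)))) (w1, b)"
      by (rule weakly_tendsto_Pair[OF weak b])
    show "\<forall>n. (w (t (r n)), \<beta> (t (r n))) \<in> S (t (r n))"
      using sol[OF t(1)] by (simp add: supports_def)
  qed
  then have "(w1, b) \<in> liminf_set S" using mosco by blast
  then have lowb: "\<mu> + p \<bullet> (w1 - w0) \<le> b" using lim unfolding supports_def by blast

  \<comment> \<open>The right-hand side of \<open>key\<close>. Its limit along \<open>r\<close> is
    nonnegative because \<open>Q\<close> dominates a square, and nonpositive by \<open>lowb\<close>;
    hence \<open>D (r n)\<close> tends to 0, which also forces strong convergence to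
    \<open>w0\<close> without first identifying \<open>w1\<close>.\<close>
  define Q where "Q n = g n \<bullet> (w (t n) - z n) + l n - \<beta> (t n)" for n
  have "(\<lambda>n. g (r n) \<bullet> w (t (r n)) - g (r n) \<bullet> z (r n) + l (r n) - \<beta> (t (r n)))
      \<longlonglongrightarrow> p \<bullet> w1 - p \<bullet> w0 + \<mu> - b"
    by (intro tendsto_intros tendsto_inner_weakly_tendsto[OF weak, of K] sub g z l b)
       (use M rM in auto)
  then have Q: "(\<lambda>n. Q (r n)) \<longlonglongrightarrow> p \<bullet> w1 - p \<bullet> w0 + \<mu> - b"
    by (simp add: Q_def inner_diff_right)
  have DQ: "\<alpha> * (D (r n))\<^sup>2 \<le> Q (r n)" for n
    using key M(1) rM unfolding Q_def by blast
  have "0 \<le> Q (r n)" for n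
    using DQ[of n] \<open>\<alpha> > 0\<close> order_trans[of 0 "\<alpha> * (D (r n))\<^sup>2" "Q (r n)"] by simp
  then have "0 \<le> p \<bullet> w1 - p \<bullet> w0 + \<mu> - b"
    by (intro LIMSEQ_le_const[OF Q]) auto
  then have "p \<bullet> w1 - p \<bullet> w0 + \<mu> - b = 0"
    using lowb by (simp add: inner_diff_right)
  with Q have Q0: "(\<lambda>n. Q (r n) / \<alpha>) \<longlonglongrightarrow> 0 / \<alpha>"
    using \<open>\<alpha> > 0\<close> by (intro tendsto_intros) auto
  have "(\<lambda>n. (D (r n))\<^sup>2) \<longlonglongrightarrow> 0"
    by (rule Lim_null_comparison[OF _ Q0[simplified]])
       (use DQ \<open>\<alpha> > 0\<close> in \<open>auto simp: field_simps intro!: always_eventually\<close>)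
  then have "(\<lambda>n. sqrt ((D (r n))\<^sup>2)) \<longlonglongrightarrow> sqrt 0" by (rule tendsto_real_sqrt)
  then have "(\<lambda>n. w (t (r n)) - z (r n)) \<longlonglongrightarrow> 0"
    by (simp add: D_def tendsto_norm_zero_iff)
  from tendsto_add[OF this sub[OF z]] have "(\<lambda>n. w (t (r n))) \<longlonglongrightarrow> w0" by simp
  with r show ?thesis by blast
qed

section \<open>Existence and uniqueness of proximal points\<close>

lemma epi_iff [simp]: "(x, r) \<in> epi f \<longleftrightarrow> f x \<le> ereal r"
  by (simp add: epi_def)

lemma Gamma0_finite:
  assumes "f \<in> Gamma0" "f x \<le> ereal r"
  obtains a where "f x = ereal a" "a \<le> r"
  using assms by (cases "f x") (auto simp: Gamma0_def)

lemma Gamma0_proper: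
  assumes "f \<in> Gamma0"
  obtains x a where "f x = ereal a"
proof -
  obtain x where "f x \<noteq> \<infinity>" "f x \<noteq> -\<infinity>" using assms by (auto simp: Gamma0_def)
  then show ?thesis using that by (cases "f x") auto
qed

lemma convex_epi_Gamma0:
  assumes "f \<in> Gamma0" shows "convex (epi f)"
  unfolding convex_alt
proof (intro ballI allI impI, clarify)
  fix x r y s and u :: real
  assume xy: "(x, r) \<in> epi f" "(y, s) \<in> epi f" and u: "0 \<le> u" "u \<le> 1"
  obtain a b where ab: "f x = ereal a" "a \<le> r" "f y = ereal b" "b \<le> s"
    using xy Gamma0_finite[OF assms] by (metis epi_iff)
  have "f ((1 - u) *\<^sub>R x + u *\<^sub>R y) \<le> ereal ((1 - u) * r + u * s)"
  proof (cases "0 < u \<and> u < 1")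
    case True
    then have "f ((1 - u) *\<^sub>R x + u *\<^sub>R y) \<le> ereal (1 - u) * f x + ereal u * f y"
      using assms by (simp add: Gamma0_def)
    also have "\<dots> = ereal ((1 - u) * a + u * b)" by (simp add: ab)
    also have "\<dots> \<le> ereal ((1 - u) * r + u * s)"
      using ab True by (simp add: add_mono mult_left_mono)
    finally show ?thesis .
  next
    case False
    then have "u = 0 \<or> u = 1" using u by auto
    then show ?thesis using xy by auto
  qed
  then show "(1 - u) *\<^sub>R (x, r) + u *\<^sub>R (y, s) \<in> epi f" by simp
qed

text \<open>If a limit point lay below the graph, a level \<open>c\<close> strictly between
  \<open>r\<close> and \<open>f x\<close> would eventually separate the values of \<open>f\<close>
  from the heights of the sequence.\<close>

lemma closed_epi_Gamma0:
  fixes f :: "'a::real_inner \<Rightarrow> ereal"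
  assumes "f \<in> Gamma0" shows "closed (epi f)"
  unfolding closed_sequential_limits
proof (intro allI impI, elim conjE)
  fix X :: "nat \<Rightarrow> 'a \<times> real" and l
  assume X: "\<forall>n. X n \<in> epi f" and lim: "X \<longlonglongrightarrow> l"
  obtain x r where l: "l = (x, r)" by (cases l)
  have "f x \<le> ereal r"
  proof (rule ccontr)
    assume "\<not> f x \<le> ereal r"
    then obtain c where c: "ereal r < ereal c" "ereal c < f x"
      using ereal_dense2 by (metis not_le)
    have "f x \<le> Liminf (at x) f" using assms by (simp add: Gamma0_def)
    then have "\<forall>\<^sub>F y in at x. ereal c < f y" using c(2) by (simp add: le_Liminf_iff)
    \<comment> \<open>\<open>Liminf (at x)\<close> ignores \<open>x\<close> itself; the choice
      \<open>c < f x\<close> fills the gap, as the sequence may visit \<open>x\<close>.\<close>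
    then have "\<forall>\<^sub>F y in nhds x. ereal c < f y"
      unfolding eventually_at_filter by (rule eventually_mono) (use c(2) in auto)
    moreover have "(\<lambda>n. fst (X n)) \<longlonglongrightarrow> x" using tendsto_fst[OF lim] l by simp
    ultimately have "\<forall>\<^sub>F n in sequentially. ereal c < f (fst (X n))"
      by (rule eventually_compose_filterlim)
    moreover have "\<forall>\<^sub>F n in sequentially. snd (X n) < c"
      using order_tendstoD(2)[OF tendsto_snd[OF lim], of c] l c(1) by simp
    ultimately have "\<forall>\<^sub>F n in sequentially. False"
    proof eventually_elim
      case (elim n)
      moreover have "f (fst (X n)) \<le> ereal (snd (X n))" using X by (simp add: epi_def case_prod_beta)
      ultimately have "ereal c < ereal (snd (X n))" by (metis less_le_trans)
      then show False using elim by simp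
    qed
    then show False by simp
  qed
  then show "l \<in> epi f" by (simp add: l)
qed

lemma subdifferential_iff_supports_epi:
  assumes "f \<in> Gamma0"
  shows "v \<in> subdifferential f y \<longleftrightarrow> (\<exists>r. supports (epi f) v y r)"
proof
  assume v: "v \<in> subdifferential f y"
  \<comment> \<open>Testing at a point of finite value excludes \<open>f y = \<infinity>\<close>,
    since then \<open>f x - f y\<close> would be \<open>-\<infinity>\<close>.\<close>
  obtain x a where x: "f x = ereal a" using Gamma0_proper[OF assms] .
  have "ereal (v \<bullet> (x - y)) \<le> f x - f y" using v by (simp add: subdifferential_def)
  then have "f y \<noteq> \<infinity>" using x by auto
  moreover have "f y \<noteq> -\<infinity>" using assms by (simp add: Gamma0_def)
  ultimately obtain b where b: "f y = ereal b" by (cases "f y") auto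
  have "b + v \<bullet> (z - y) \<le> s" if z: "f z \<le> ereal s" for z s
  proof -
    obtain c where c: "f z = ereal c" "c \<le> s" using Gamma0_finite[OF assms z] .
    have "ereal (v \<bullet> (z - y)) \<le> f z - f y" using v by (simp add: subdifferential_def)
    then show ?thesis using b c by simp
  qed
  then show "\<exists>r. supports (epi f) v y r"
    by (intro exI[of _ b]) (simp add: supports_def b)
next
  assume "\<exists>r. supports (epi f) v y r"
  then obtain r where r: "f y \<le> ereal r" "\<And>z s. f z \<le> ereal s \<Longrightarrow> r + v \<bullet> (z - y) \<le> s"
    by (auto simp: supports_def)
  obtain b where b: "f y = ereal b" "b \<le> r" using Gamma0_finite[OF assms r(1)] .
  have "ereal (v \<bullet> (z - y)) \<le> f z - f y" for z
  proof (cases "f z")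
    case (real c)
    then show ?thesis using r(2)[of z c] b by simp
  qed (use assms b in \<open>auto simp: Gamma0_def\<close>)
  then show "v \<in> subdifferential f y" by (simp add: subdifferential_def)
qed

section \<open>Resolvents, fixed points and uniqueness\<close>

lemma supports_monotone:
  assumes "supports S v1 y1 r1" "supports S v2 y2 r2"
  shows "0 \<le> (v1 - v2) \<bullet> (y1 - y2)"
proof -
  have "r1 + v1 \<bullet> (y2 - y1) \<le> r2" "r2 + v2 \<bullet> (y1 - y2) \<le> r1"
    using assms unfolding supports_def by blast+
  then show ?thesis by (simp add: inner_diff_left inner_diff_right)
qed

text \<open>Closedness leaves a ball around \<open>(x0, a - 1)\<close> outside the epigraph, hence a
  local lower bound for \<open>f\<close>. Convexity extends it to a cone, and the quadratic term
  outgrows the cone.\<close>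

lemma Gamma0_resolvent:
  fixes f :: "'a::{real_inner, complete_space} \<Rightarrow> ereal"
  assumes "f \<in> Gamma0" "k > 0"
  shows "\<exists>y r. supports (epi f) (k *\<^sub>R (x - y)) y r"
proof -
  obtain x0 a where x0: "f x0 = ereal a" using Gamma0_proper[OF assms(1)] .
  have "open (- epi f)" using closed_epi_Gamma0[OF assms(1)] by (rule open_Compl)
  moreover have "(x0, a - 1) \<in> - epi f" by (simp add: x0)
  ultimately obtain d where d: "d > 0" "ball (x0, a - 1) d \<subseteq> - epi f"
    unfolding open_contains_ball by blast
  have near: "a - 1 \<le> r" if "(y, r) \<in> epi f" "norm (y - x0) < d" for y r
  proof (rule ccontr)
    assume "\<not> a - 1 \<le> r"
    then have "(y, a - 1) \<in> epi f"
      using that(1) order_trans[of "f y" "ereal r" "ereal (a - 1)"] by simp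
    moreover have "(y, a - 1) \<in> ball (x0, a - 1) d"
      using that(2) by (simp add: dist_prod_def dist_norm norm_minus_commute)
    ultimately show False using d(2) by blast
  qed
  define e where "e = 1 / d"
  have low: "a - 1 - e * norm (y - x0) \<le> r" if "(y, r) \<in> epi f" for y r
  proof -
    have "a - 1 - (a - (a - 1)) / d * norm (y - x0) \<le> r"
      by (rule convex_minorant[where S = "epi f"])
         (use convex_epi_Gamma0[OF assms(1)] x0 d(1) near that in auto)
    then show ?thesis by (simp add: e_def)
  qed
  \<comment> \<open>The cone is recentred at \<open>x\<close> by the triangle inequality; completing
    the square absorbs \<open>e * norm (y - x)\<close> into the quadratic at the cost of
    \<open>e\<^sup>2 / (2 * k)\<close>.\<close>
  define c where "c = a - 1 - e * norm (x - x0) - e\<^sup>2 / (2 * k)"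
  show ?thesis
  proof (rule exists_resolvent_supports[where c = c])
    show "epi f \<noteq> {}" using x0 by (metis empty_iff epi_iff order_refl)
  next
    fix y r assume "(y, r) \<in> epi f"
    from low[OF this] have "a - 1 - e * norm (y - x0) \<le> r" .
    moreover have "e * norm (y - x0) \<le> e * norm (y - x) + e * norm (x - x0)"
      using norm_triangle_ineq[of "y - x" "x - x0"] d(1)
      by (simp add: e_def divide_right_mono flip: add_divide_distrib)
    moreover have "0 \<le> (k * norm (y - x) - e)\<^sup>2 / (2 * k)" using assms(2) by simp
    then have "e * norm (y - x) \<le> k / 2 * (norm (y - x))\<^sup>2 + e\<^sup>2 / (2 * k)"
      using assms(2) by (simp add: power2_eq_square field_simps)
    ultimately show "c \<le> r + k / 2 * (norm (y - x))\<^sup>2" unfolding c_def by linarith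
  qed (use assms closed_epi_Gamma0 convex_epi_Gamma0 in auto)
qed

text \<open>Forward-backward splitting: \<open>J\<close> is the nonexpansive resolvent of the
  subdifferential and \<open>T\<close> an explicit step for \<open>A\<close>. A fixed point of
  \<open>J\<close> after \<open>T\<close> has slope \<open>k *\<^sub>R (T y - y) = x - A y\<close>,
  as required, and Banach's theorem provides one because \<open>T\<close> is a contraction.\<close>

lemma exists_prox:
  fixes A :: "'a::{real_inner, complete_space} \<Rightarrow> 'a"
  assumes "A \<in> A_class" "f \<in> Gamma0"
  shows "\<exists>y r. supports (epi f) (x - A y) y r"
proof -
  obtain M0 \<alpha> where M0: "M0-lipschitz_on UNIV A" and \<alpha>: "\<alpha> > 0" "strongly_monotone \<alpha> A"
    using assms(1) by (auto simp: A_class_def)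
  \<comment> \<open>Enlarging the Lipschitz constant makes \<open>M\<close> positive and
    \<open>\<alpha> / M \<le> 1\<close>, so that the contraction factor \<open>c\<close> below is
    the root of a number in \<open>[0, 1)\<close>.\<close>
  define M where "M = max M0 \<alpha>"
  have M: "M \<ge> \<alpha>" "M > 0" using \<alpha> by (auto simp: M_def)
  have lip: "norm (A a - A b) \<le> M * norm (a - b)" for a b
    using lipschitz_onD[OF lipschitz_on_le[OF M0], of M a b] by (simp add: M_def dist_norm)
  define k where "k = M\<^sup>2 / \<alpha>"
  have k: "k > 0" using M \<alpha> by (simp add: k_def)
  obtain J R where J: "\<And>z. supports (epi f) (k *\<^sub>R (z - J z)) (J z) (R z)"
    using Gamma0_resolvent[OF assms(2) k] by metis
  have J_lip: "norm (J a - J b) \<le> norm (a - b)" for a b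
  proof -
    have "0 \<le> (k *\<^sub>R (a - J a) - k *\<^sub>R (b - J b)) \<bullet> (J a - J b)"
      by (rule supports_monotone[OF J J])
    also have "\<dots> = k * ((a - b) \<bullet> (J a - J b) - (norm (J a - J b))\<^sup>2)"
      unfolding power2_norm_eq_inner by (simp add: inner_diff_left inner_diff_right algebra_simps)
    finally have "(norm (J a - J b))\<^sup>2 \<le> (a - b) \<bullet> (J a - J b)"
      using k by (simp add: zero_le_mult_iff)
    also have "\<dots> \<le> norm (a - b) * norm (J a - J b)" by (rule norm_cauchy_schwarz)
    finally show ?thesis by (cases "norm (J a - J b) = 0") (auto simp: power2_eq_square)
  qed
  define T where "T y = y + (x - A y) /\<^sub>R k" for y
  \<comment> \<open>The step \<open>1 / k\<close> minimises the Lipschitz bound \<open>1 - 2 * \<alpha> / k + M\<^sup>2 / k\<^sup>2\<close> for the square of \<open>T\<close>.\<close>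
  define c where "c = sqrt (1 - \<alpha>\<^sup>2 / M\<^sup>2)"
  have frac: "\<alpha>\<^sup>2 / M\<^sup>2 \<le> 1" using M \<alpha> by (simp add: power_mono)
  have T_lip: "norm (T a - T b) \<le> c * norm (a - b)" for a b
  proof (rule power2_le_imp_le)
    have ip: "(A a - A b) \<bullet> (a - b) \<ge> \<alpha> * (norm (a - b))\<^sup>2"
      using \<alpha>(2) by (simp add: strongly_monotone_def)
    have "T a - T b = (a - b) - (A a - A b) /\<^sub>R k"
      by (simp add: T_def algebra_simps)
    moreover have "(norm (u - v /\<^sub>R k))\<^sup>2
        = (norm u)\<^sup>2 - 2 * (v \<bullet> u) / k + (norm v)\<^sup>2 / k\<^sup>2" for u v :: 'a
      unfolding power2_norm_eq_inner
      by (simp add: inner_diff_left inner_diff_right inner_commute[of u v] power2_eq_square divide_inverse right_diff_distrib)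
    ultimately have "(norm (T a - T b))\<^sup>2
        = (norm (a - b))\<^sup>2 - 2 * ((A a - A b) \<bullet> (a - b)) / k + (norm (A a - A b))\<^sup>2 / k\<^sup>2"
      by simp
    also have "\<dots> \<le> (norm (a - b))\<^sup>2 - 2 * (\<alpha> * (norm (a - b))\<^sup>2) / k + (M * norm (a - b))\<^sup>2 / k\<^sup>2"
      using ip k lip[of a b] by (intro add_mono diff_mono divide_right_mono power_mono) auto
    also have "\<dots> = (1 - \<alpha>\<^sup>2 / M\<^sup>2) * (norm (a - b))\<^sup>2"
      using M \<alpha> by (simp add: k_def field_simps power2_eq_square)
    finally show "(norm (T a - T b))\<^sup>2 \<le> (c * norm (a - b))\<^sup>2"
      using frac by (simp add: c_def power_mult_distrib)
    show "0 \<le> c * norm (a - b)" using frac by (simp add: c_def)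
  qed
  have "\<exists>!y. J (T y) = y"
  proof (rule banach_fix_type)
    show "0 \<le> c" "c < 1" using frac M \<alpha> by (simp_all add: c_def)
    show "\<forall>a b. dist (J (T a)) (J (T b)) \<le> c * dist a b"
      using J_lip T_lip order_trans unfolding dist_norm by blast
  qed
  then obtain y where y: "J (T y) = y" by blast
  have "k *\<^sub>R (T y - y) = x - A y" using k by (simp add: T_def)
  then show ?thesis using J[of "T y"] y by auto
qed

lemma supports_strongly_monotone_unique:
  assumes "strongly_monotone \<alpha> A" "\<alpha> > 0"
    and "supports S (x - A y1) y1 r1" "supports S (x - A y2) y2 r2"
  shows "y1 = y2"
proof -
  have "0 \<le> ((x - A y1) - (x - A y2)) \<bullet> (y1 - y2)"
    by (rule supports_monotone) (use assms in auto)
  moreover have "\<alpha> * (norm (y1 - y2))\<^sup>2 \<le> (A y1 - A y2) \<bullet> (y1 - y2)"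
    using assms(1) by (simp add: strongly_monotone_def)
  ultimately have "\<alpha> * (norm (y1 - y2))\<^sup>2 \<le> 0" by (simp add: inner_diff_left)
  then show ?thesis using \<open>\<alpha> > 0\<close> by (simp add: mult_le_0_iff)
qed

lemma prox_eqI:
  assumes "A \<in> A_class" "f \<in> Gamma0" "supports (epi f) (x - A y) y r"
  shows "prox A f x = y"
proof -
  obtain \<alpha> where \<alpha>: "\<alpha> > 0" "strongly_monotone \<alpha> A"
    using assms(1) by (auto simp: A_class_def)
  have eq: "x \<in> {A y' + v |v. v \<in> subdifferential f y'} \<longleftrightarrow> (\<exists>r. supports (epi f) (x - A y') y' r)" for y'
    unfolding subdifferential_iff_supports_epi[OF assms(2), symmetric]
    by (auto simp: algebra_simps intro!: exI[of _ "x - A y'"])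
  show ?thesis
    unfolding prox_def eq
    by (rule the_equality) (use assms(3) supports_strongly_monotone_unique[OF \<alpha>(2,1)] in blast)+
qed

lemma prox_supports:
  fixes A :: "'a::{real_inner, complete_space} \<Rightarrow> 'a"
  assumes "A \<in> A_class" "f \<in> Gamma0"
  obtains r where "supports (epi f) (x - A (prox A f x)) (prox A f x) r"
  using exists_prox[OF assms, of x] prox_eqI[OF assms] by metis

section \<open>Difference quotients\<close>

text \<open>The epigraph of the second quotient is the preimage of \<open>epi (f \<tau>)\<close>
  under an affine bijection, through which convexity and supports are transferred.\<close>

lemma epi_second_quotient_iff:
  assumes "\<tau> > 0" "f \<tau> x = ereal c"
  shows "(w, r) \<in> epi (second_quotient f x v \<tau>) \<longleftrightarrow>
    (x + \<tau> *\<^sub>R w, c + \<tau> * (v \<bullet> w) + \<tau>\<^sup>2 * r) \<in> epi (f \<tau>)"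
proof (cases "f \<tau> (x + \<tau> *\<^sub>R w)")
  case (real a)
  then have "second_quotient f x v \<tau> w = ereal ((a - c - \<tau> * (v \<bullet> w)) / \<tau>\<^sup>2)"
    using assms by (simp add: second_quotient_def)
  moreover have "(a - c - \<tau> * (v \<bullet> w)) / \<tau>\<^sup>2 \<le> r \<longleftrightarrow> a \<le> c + \<tau> * (v \<bullet> w) + \<tau>\<^sup>2 * r"
    using assms by (subst pos_divide_le_eq) (auto simp: mult.commute[of r])
  ultimately show ?thesis using real by simp
qed (use assms in \<open>auto simp: second_quotient_def\<close>)

lemma convex_epi_second_quotient:
  assumes "\<tau> > 0" "f \<tau> x = ereal c" "convex (epi (f \<tau>))"
  shows "convex (epi (second_quotient f x v \<tau>))"
proof (rule convexI, clarify)
  fix w1 r1 w2 r2 and a b :: real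
  assume w: "(w1, r1) \<in> epi (second_quotient f x v \<tau>)" "(w2, r2) \<in> epi (second_quotient f x v \<tau>)"
    and ab: "0 \<le> a" "0 \<le> b" "a + b = 1"
  have a: "a = 1 - b" using ab by simp
  have "a *\<^sub>R (x + \<tau> *\<^sub>R w1, c + \<tau> * (v \<bullet> w1) + \<tau>\<^sup>2 * r1)
      + b *\<^sub>R (x + \<tau> *\<^sub>R w2, c + \<tau> * (v \<bullet> w2) + \<tau>\<^sup>2 * r2) \<in> epi (f \<tau>)"
    using w ab assms by (intro convexD) (auto simp: epi_second_quotient_iff simp del: epi_iff)
  also have "a *\<^sub>R (x + \<tau> *\<^sub>R w1, c + \<tau> * (v \<bullet> w1) + \<tau>\<^sup>2 * r1)
      + b *\<^sub>R (x + \<tau> *\<^sub>R w2, c + \<tau> * (v \<bullet> w2) + \<tau>\<^sup>2 * r2)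
    = (x + \<tau> *\<^sub>R (a *\<^sub>R w1 + b *\<^sub>R w2),
       c + \<tau> * (v \<bullet> (a *\<^sub>R w1 + b *\<^sub>R w2)) + \<tau>\<^sup>2 * (a * r1 + b * r2))"
    unfolding a by (simp add: inner_add_right algebra_simps)
  finally show "a *\<^sub>R (w1, r1) + b *\<^sub>R (w2, r2) \<in> epi (second_quotient f x v \<tau>)"
    using assms by (simp add: epi_second_quotient_iff del: epi_iff)
qed

text \<open>Arguments are scaled by \<open>\<tau>\<close> and heights by
  \<open>\<tau>\<^sup>2\<close>, so slopes, after subtracting \<open>v\<close>, are divided by
  \<open>\<tau>\<close>.\<close>

lemma supports_second_quotient:
  assumes "\<tau> > 0" "f \<tau> x = ereal c" "supports (epi (f \<tau>)) u y b"
  defines "w \<equiv> (y - x) /\<^sub>R \<tau>"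
  shows "supports (epi (second_quotient f x v \<tau>)) ((u - v) /\<^sub>R \<tau>) w
    ((b - c - \<tau> * (v \<bullet> w)) / \<tau>\<^sup>2)"
proof -
  have y: "y = x + \<tau> *\<^sub>R w" using assms(1) by (simp add: w_def)
  have b: "c + \<tau> * (v \<bullet> w) + \<tau>\<^sup>2 * ((b - c - \<tau> * (v \<bullet> w)) / \<tau>\<^sup>2) = b"
    using assms(1) by simp
  show ?thesis
    unfolding supports_def epi_second_quotient_iff[where f = f, OF assms(1,2)] b y[symmetric]
  proof (intro conjI allI impI)
    show "(y, b) \<in> epi (f \<tau>)" using assms(3) by (simp add: supports_def del: epi_iff)
  next
    fix z s assume "(x + \<tau> *\<^sub>R z, c + \<tau> * (v \<bullet> z) + \<tau>\<^sup>2 * s) \<in> epi (f \<tau>)"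
    then have "b + u \<bullet> (x + \<tau> *\<^sub>R z - y) \<le> c + \<tau> * (v \<bullet> z) + \<tau>\<^sup>2 * s"
      using assms(3) unfolding supports_def by blast
    also have "x + \<tau> *\<^sub>R z - y = \<tau> *\<^sub>R (z - w)" by (simp add: y algebra_simps)
    finally have "b - c - \<tau> * (v \<bullet> w) + \<tau> * ((u - v) \<bullet> (z - w)) \<le> s * \<tau>\<^sup>2"
      by (simp add: inner_diff_left inner_diff_right algebra_simps)
    then have "(b - c - \<tau> * (v \<bullet> w) + \<tau> * ((u - v) \<bullet> (z - w))) / \<tau>\<^sup>2 \<le> s"
      using assms(1) by (simp add: pos_divide_le_eq)
    also have "(b - c - \<tau> * (v \<bullet> w) + \<tau> * ((u - v) \<bullet> (z - w))) / \<tau>\<^sup>2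
        = (b - c - \<tau> * (v \<bullet> w)) / \<tau>\<^sup>2 + ((u - v) /\<^sub>R \<tau>) \<bullet> (z - w)"
      using assms(1) by (simp add: add_divide_distrib power2_eq_square inverse_eq_divide)
    finally show "(b - c - \<tau> * (v \<bullet> w)) / \<tau>\<^sup>2 + ((u - v) /\<^sub>R \<tau>) \<bullet> (z - w) \<le> s" .
  qed
qed

section \<open>Semi-derivatives as limits of difference quotients\<close>

lemma semi_quotient_tendsto:
  assumes "semi_differentiable A x"
    and "\<And>n. s n > 0" "s \<longlonglongrightarrow> 0" "z \<longlonglongrightarrow> w"
  shows "(\<lambda>n::nat. semi_quotient A x (s n, z n)) \<longlonglongrightarrow> semi_deriv A x w"
proof -
  let ?F = "at_right (0::real) \<times>\<^sub>F nhds w"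
  obtain l where l: "(semi_quotient A x \<longlongrightarrow> l) ?F"
    using assms(1) unfolding semi_differentiable_def by blast
  have "?F \<noteq> bot" by (simp add: prod_filter_eq_bot)
  then have "semi_deriv A x w = l"
    unfolding semi_deriv_def using l by (rule tendsto_Lim)
  moreover have "s n \<in> {0<..} \<and> s n \<noteq> 0" for n using assms(2)[of n] by simp
  then have "filterlim s (at_right 0) sequentially"
    using assms(3) by (simp add: filterlim_at)
  then have "filterlim (\<lambda>n. (s n, z n)) ?F sequentially"
    using assms(4) by (rule filterlim_Pair)
  ultimately show ?thesis using filterlim_compose[OF l] by simp
qed

lemma strongly_monotone_semi_quotient:
  assumes "strongly_monotone \<alpha> (A \<tau>)" "\<tau> > 0"
  shows "strongly_monotone \<alpha> (\<lambda>w. semi_quotient A x (\<tau>, w))"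
  unfolding strongly_monotone_def
proof (intro allI)
  fix a b
  have "\<alpha> * (norm (\<tau> *\<^sub>R (b - a)))\<^sup>2 \<le> (A \<tau> (x + \<tau> *\<^sub>R b) - A \<tau> (x + \<tau> *\<^sub>R a)) \<bullet> (\<tau> *\<^sub>R (b - a))"
    using assms(1)[unfolded strongly_monotone_def, rule_format, of "x + \<tau> *\<^sub>R b" "x + \<tau> *\<^sub>R a"]
    by (simp add: scaleR_diff_right)
  also have "A \<tau> (x + \<tau> *\<^sub>R b) - A \<tau> (x + \<tau> *\<^sub>R a)
      = \<tau> *\<^sub>R (semi_quotient A x (\<tau>, b) - semi_quotient A x (\<tau>, a))"
    using assms(2) by (simp add: semi_quotient_def flip: scaleR_diff_right)
  finally have "\<tau>\<^sup>2 * (\<alpha> * (norm (b - a))\<^sup>2)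
      \<le> \<tau>\<^sup>2 * ((semi_quotient A x (\<tau>, b) - semi_quotient A x (\<tau>, a)) \<bullet> (b - a))"
    by (simp add: power_mult_distrib power2_eq_square mult_ac)
  then show "\<alpha> * (norm (b - a))\<^sup>2
      \<le> (semi_quotient A x (\<tau>, b) - semi_quotient A x (\<tau>, a)) \<bullet> (b - a)"
    using assms(2) by simp
qed

lemma lipschitz_semi_quotient:
  assumes "M-lipschitz_on UNIV (A \<tau>)" "\<tau> > 0"
  shows "M-lipschitz_on UNIV (\<lambda>w. semi_quotient A x (\<tau>, w))"
proof (rule lipschitz_onI)
  fix a b
  have "semi_quotient A x (\<tau>, a) - semi_quotient A x (\<tau>, b)
      = (A \<tau> (x + \<tau> *\<^sub>R a) - A \<tau> (x + \<tau> *\<^sub>R b)) /\<^sub>R \<tau>"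
    by (simp add: semi_quotient_def flip: scaleR_diff_right)
  then have "dist (semi_quotient A x (\<tau>, a)) (semi_quotient A x (\<tau>, b))
      = dist (A \<tau> (x + \<tau> *\<^sub>R a)) (A \<tau> (x + \<tau> *\<^sub>R b)) / \<tau>"
    using assms(2) by (simp add: dist_norm divide_inverse)
  also have "\<dots> \<le> M * dist (x + \<tau> *\<^sub>R a) (x + \<tau> *\<^sub>R b) / \<tau>"
    using assms(2) by (intro divide_right_mono lipschitz_onD[OF assms(1)]) auto
  also have "dist (x + \<tau> *\<^sub>R a) (x + \<tau> *\<^sub>R b) = \<tau> * dist a b"
    using assms(2) by (simp add: dist_norm flip: scaleR_diff_right)
  finally show "dist (semi_quotient A x (\<tau>, a)) (semi_quotient A x (\<tau>, b)) \<le> M * dist a b"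
    using assms(2) by simp
qed (use assms lipschitz_on_nonneg in blast)

text \<open>The quotients inherit the constants \<open>M\<close> and \<open>\<alpha>\<close>, which
  are uniform in time, so both inequalities survive the limit along
  \<open>1 / (n + 1)\<close>.\<close>

lemma semi_deriv_A_class:
  assumes "A \<in> A_class_unif" "semi_differentiable A x"
  shows "semi_deriv A x \<in> A_class"
proof -
  obtain M \<alpha> where \<alpha>: "\<alpha> > 0" and A: "\<And>t. t \<ge> 0 \<Longrightarrow> M-lipschitz_on UNIV (A t)"
      "\<And>t. t \<ge> 0 \<Longrightarrow> strongly_monotone \<alpha> (A t)"
    using assms(1) by (auto simp: A_class_unif_def)
  let ?s = "\<lambda>n. inverse (real (Suc n))"
  have lim: "(\<lambda>n. semi_quotient A x (?s n, w)) \<longlonglongrightarrow> semi_deriv A x w" for w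
    by (rule semi_quotient_tendsto[OF assms(2) _ LIMSEQ_inverse_real_of_nat tendsto_const]) simp
  have "M-lipschitz_on UNIV (semi_deriv A x)"
  proof (rule lipschitz_onI)
    fix a b
    have "dist (semi_quotient A x (?s n, a)) (semi_quotient A x (?s n, b)) \<le> M * dist a b" for n
      by (rule lipschitz_onD[OF lipschitz_semi_quotient[OF A(1)]]) auto
    then show "dist (semi_deriv A x a) (semi_deriv A x b) \<le> M * dist a b"
      by (intro LIMSEQ_le_const2[OF tendsto_dist[OF lim lim]]) auto
  qed (use A(1)[of 0] lipschitz_on_nonneg in blast)
  moreover have "strongly_monotone \<alpha> (semi_deriv A x)"
    unfolding strongly_monotone_def
  proof (intro allI)
    fix a b
    have "\<alpha> * (norm (b - a))\<^sup>2
        \<le> (semi_quotient A x (?s n, b) - semi_quotient A x (?s n, a)) \<bullet> (b - a)" for n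
      using strongly_monotone_semi_quotient[where \<tau> = "?s n" and x = x, OF A(2)]
      by (simp add: strongly_monotone_def)
    then show "\<alpha> * (norm (b - a))\<^sup>2 \<le> (semi_deriv A x b - semi_deriv A x a) \<bullet> (b - a)"
      by (intro LIMSEQ_le_const[OF tendsto_inner[OF tendsto_diff[OF lim lim] tendsto_const]]) auto
  qed
  ultimately show ?thesis using \<alpha> by (auto simp: A_class_def)
qed

section \<open>One-sided derivatives and limits along sequences\<close>

lemma has_vector_derivative_at_0_Ici_iff:
  "(g has_vector_derivative d) (at 0 within {0..}) \<longleftrightarrow>
     ((\<lambda>t. (g t - g 0) /\<^sub>R t) \<longlongrightarrow> d) (at_right 0)"
proof -
  have "(g has_vector_derivative d) (at 0 within {0..}) \<longleftrightarrow>
     ((\<lambda>t. (g t - (g 0 + t *\<^sub>R d)) /\<^sub>R \<bar>t\<bar>) \<longlongrightarrow> 0) (at_right 0)"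
    unfolding has_vector_derivative_def has_derivative_within at_within_Ici_at_right
    by (simp add: bounded_linear_scaleR_left divide_inverse)
  also have "\<dots> \<longleftrightarrow> ((\<lambda>t. (g t - g 0) /\<^sub>R t - d) \<longlongrightarrow> 0) (at_right 0)"
  proof (rule filterlim_cong[OF refl refl])
    show "\<forall>\<^sub>F t in at_right 0. (g t - (g 0 + t *\<^sub>R d)) /\<^sub>R \<bar>t\<bar> = (g t - g 0) /\<^sub>R t - d"
      by (rule eventually_mono[OF eventually_at_right_less]) (simp add: scaleR_diff_right scaleR_add_right)
  qed
  finally show ?thesis by (simp add: LIM_zero_iff)
qed

text \<open>Subsequence principle: failure of convergence yields a positive null sequence whose
  images stay at distance at least \<open>e\<close> from \<open>l\<close>, and so do those of each
  of its subsequences.\<close>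

lemma tendsto_at_rightI_subsequence:
  fixes w :: "real \<Rightarrow> 'a::metric_space"
  assumes "\<And>t. (\<And>n::nat. t n > 0) \<Longrightarrow> t \<longlonglongrightarrow> 0 \<Longrightarrow> \<exists>r. strict_mono r \<and> (\<lambda>n. w (t (r n))) \<longlonglongrightarrow> l"
  shows "(w \<longlongrightarrow> l) (at_right 0)"
  unfolding tendsto_at_iff_sequentially
proof (intro allI impI, rule ccontr)
  fix t :: "nat \<Rightarrow> real"
  assume t: "\<forall>i. t i \<in> {0<..} - {0}" "t \<longlonglongrightarrow> 0" and "\<not> (w \<circ> t) \<longlonglongrightarrow> l"
  then obtain e where e: "e > 0" "\<And>N. \<exists>n\<ge>N. e \<le> dist (w (t n)) l"
    unfolding lim_sequentially by (auto simp: not_less)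
  obtain n where n: "\<And>N. n N \<ge> N" "\<And>N. e \<le> dist (w (t (n N))) l"
    using e(2) by metis
  have "filterlim n at_top sequentially"
    by (rule filterlim_at_top_mono[OF filterlim_ident]) (use n in auto)
  then have "(\<lambda>k. t (n k)) \<longlonglongrightarrow> 0" by (rule filterlim_compose[OF t(2)])
  then obtain r where "(\<lambda>k. w (t (n (r k)))) \<longlonglongrightarrow> l"
    using assms[of "\<lambda>k. t (n k)"] t(1) by (metis DiffD1 greaterThan_iff)
  then obtain k where "dist (w (t (n (r k)))) l < e"
    using e(1) unfolding lim_sequentially by blast
  then show False using n(2)[of "r k"] by simp
qed

section \<open>Differentiability of the proximal curve at zero\<close>

theorem theorem42:
  fixes A :: "real \<Rightarrow> 'h::{real_inner, complete_space} \<Rightarrow> 'h"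
    and f :: "real \<Rightarrow> 'h \<Rightarrow> ereal"
    and x y :: "real \<Rightarrow> 'h"
    and v0 :: 'h
  assumes "A \<in> A_class_t" and "f \<in> Gamma0_t"
    and "\<forall>t\<ge>0. y t = prox (A t) (f t) (x t)"
    and "v0 = x 0 - A 0 (y 0)"
    and "x differentiable (at 0 within {0..})"
    and "A \<in> A_class_unif"
    and "semi_differentiable A (y 0)"
    and "twice_epi_differentiable f (y 0) v0"
    and "second_epi_deriv f (y 0) v0 \<in> Gamma0"
  shows "(y has_vector_derivative
            prox (semi_deriv A (y 0)) (second_epi_deriv f (y 0) v0)
              (vector_derivative x (at 0 within {0..})))
         (at 0 within {0..})"
proof -
  define x' where "x' = vector_derivative x (at 0 within {0..})"
  define D where "D = semi_deriv A (y 0)"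
  define \<phi> where "\<phi> = second_epi_deriv f (y 0) v0"
  define S where "S \<tau> = epi (second_quotient f (y 0) v0 \<tau>)" for \<tau>
  define w0 where "w0 = prox D \<phi> x'"
  define B where "B \<tau> w = semi_quotient A (y 0) (\<tau>, w)" for \<tau> w
  define \<xi> where "\<xi> \<tau> = (x \<tau> - x 0) /\<^sub>R \<tau>" for \<tau>
  define w where "w \<tau> = (y \<tau> - y 0) /\<^sub>R \<tau>" for \<tau>
  obtain \<alpha> where \<alpha>: "\<alpha> > 0" "\<And>t. t \<ge> 0 \<Longrightarrow> strongly_monotone \<alpha> (A t)"
    using assms(6) by (auto simp: A_class_unif_def)
  have f: "f t \<in> Gamma0" and A: "A t \<in> A_class" if "t \<ge> 0" for t
    using assms(1,2) that by (auto simp: Gamma0_t_def A_class_t_def)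
  obtain c where c: "\<And>t. t \<ge> 0 \<Longrightarrow> f t (y 0) = ereal (c t)"
  proof
    fix t :: real assume "t \<ge> 0"
    then show "f t (y 0) = ereal (real_of_ereal (f t (y 0)))"
      using assms(8) by (auto simp: twice_epi_differentiable_def finite_dom_def ereal_real)
  qed
  have "\<exists>b. supports (epi (f t)) (x t - A t (y t)) (y t) b" if "t \<ge> 0" for t
    using prox_supports[OF A[OF that] f[OF that], of "x t"] assms(3) that by metis
  then obtain b where b: "\<And>t. t \<ge> 0 \<Longrightarrow> supports (epi (f t)) (x t - A t (y t)) (y t) (b t)"
    by metis
  have epi_\<phi>: "epi \<phi> = liminf_set S"
    by (simp add: \<phi>_def second_epi_deriv_def epi_M_lim S_def[abs_def])
  \<comment> \<open>The limit inclusion solved by \<open>w0\<close>, expressed through the limit set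
    itself, as \<open>mosco_stability\<close> expects.\<close>
  obtain \<mu> where \<mu>: "supports (liminf_set S) (x' - D w0) w0 \<mu>"
    using prox_supports[OF semi_deriv_A_class[OF assms(6,7)] assms(9), of x']
    by (auto simp: w0_def D_def \<phi>_def[symmetric] epi_\<phi>)

  have "\<exists>r. strict_mono r \<and> (\<lambda>n. w (t (r n))) \<longlonglongrightarrow> w0"
    if t: "\<And>n. t n > 0" "t \<longlonglongrightarrow> 0" for t :: "nat \<Rightarrow> real"
  proof (rule mosco_stability[where B = B and \<xi> = \<xi>
        and \<beta> = "\<lambda>\<tau>. (b \<tau> - c \<tau> - \<tau> * (v0 \<bullet> w \<tau>)) / \<tau>\<^sup>2", OF _ _ _ \<mu> _ \<alpha>(1) _ _ t])
    show "w_limsup_set S \<subseteq> liminf_set S"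
      using assms(8)
      by (simp add: twice_epi_differentiable_def M_convergent_def M_convergent_set_def S_def[abs_def])
  next
    fix \<tau> :: real assume "\<tau> > 0"
    then show "convex (S \<tau>)"
      unfolding S_def by (intro convex_epi_second_quotient[where c = "c \<tau>"] c convex_epi_Gamma0 f) auto
    show "strongly_monotone \<alpha> (B \<tau>)"
      unfolding B_def[abs_def] using \<alpha>(2) \<open>\<tau> > 0\<close> by (intro strongly_monotone_semi_quotient) auto
    \<comment> \<open>Since \<open>y 0 + \<tau> *\<^sub>R w \<tau> = y \<tau>\<close> and
      \<open>v0 = x 0 - A 0 (y 0)\<close>, the difference of quotients is the rescaled subgradient
      of \<open>f \<tau>\<close> at \<open>y \<tau>\<close>.\<close>
    have eq: "\<xi> \<tau> - B \<tau> (w \<tau>) = (x \<tau> - A \<tau> (y \<tau>) - v0) /\<^sub>R \<tau>"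
      using \<open>\<tau> > 0\<close> assms(4)
      by (simp add: \<xi>_def B_def w_def semi_quotient_def scaleR_diff_right scaleR_add_right)
    show "supports (S \<tau>) (\<xi> \<tau> - B \<tau> (w \<tau>)) (w \<tau>) ((b \<tau> - c \<tau> - \<tau> * (v0 \<bullet> w \<tau>)) / \<tau>\<^sup>2)"
      unfolding S_def eq unfolding w_def
      using \<open>\<tau> > 0\<close> by (intro supports_second_quotient c b) auto
    show "(y, r') \<in> S \<tau>" if "(y, r) \<in> S \<tau>" "r \<le> r'" for y r r'
      using that order_trans[of _ "ereal r" "ereal r'"] by (simp add: S_def)
  next
    fix s :: "nat \<Rightarrow> real" and z
    assume s: "\<And>n. s n > 0" "s \<longlonglongrightarrow> 0" "z \<longlonglongrightarrow> w0"
    have "(x has_vector_derivative x') (at 0 within {0..})"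
      using assms(5) by (simp add: x'_def vector_derivative_works)
    then have "(\<xi> \<longlongrightarrow> x') (at_right 0)"
      by (simp add: has_vector_derivative_at_0_Ici_iff \<xi>_def[abs_def])
    then have "(\<lambda>n. \<xi> (s n)) \<longlonglongrightarrow> x'"
      using s(1,2) by (auto simp: tendsto_at_iff_sequentially o_def less_imp_neq)
    moreover have "(\<lambda>n. B (s n) (z n)) \<longlonglongrightarrow> D w0"
      unfolding B_def D_def by (rule semi_quotient_tendsto[OF assms(7) s])
    ultimately show "(\<lambda>n. \<xi> (s n) - B (s n) (z n)) \<longlonglongrightarrow> x' - D w0"
      by (rule tendsto_diff)
  qed
  then have "(w \<longlongrightarrow> w0) (at_right 0)" by (rule tendsto_at_rightI_subsequence)
  then show ?thesis
    by (simp add: has_vector_derivative_at_0_Ici_iff w_def[abs_def] w0_def x'_def D_def \<phi>_def)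
qed

end
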